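(* Let $G$ be a finite abelian group. Then the endomorphism ring $\operatorname{End}(G)$ is a generalized $t$-fine ring if and only if $G\cong (\mathbb{Z}_{p^k})^n$ for some prime $p$ and positive integers $k,n$.
   Context: For a ring $R$ with identity: $\mathrm{J}(R)$ is the Jacobson radical, $\mathrm{Nil}(R)$ the set of nilpotent elements, and $\mathcal{T}(R)$ the set of torsion units, i.e. units $u$ with $u^m=1$ for some $m\ge 1$. $R$ is generalized $t$-fine if $R\setminus \mathrm{J}(R)=\mathcal{T}(R)+\mathrm{Nil}(R)$ (in particular, the zero ring does not satisfy this equality). $\mathbb{Z}_{m}$ denotes the cyclic group $\mathbb{Z}/m\mathbb{Z}$. *)

theory Defs
  imports "HOL-Algebra.Algebra" "HOL-Computational_Algebra.Primes"
begin

section \<open>The Jacobson radical\<close>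

text \<open>Left-sided analogues of the library locales \<^locale>\<open>ideal\<close> and \<^locale>\<open>maximalideal\<close>.\<close>

locale left_ideal = additive_subgroup I R + ring R for I and R (structure) +
  assumes left_closed: "\<lbrakk>a \<in> I; x \<in> carrier R\<rbrakk> \<Longrightarrow> x \<otimes> a \<in> I"

locale maximal_left_ideal = left_ideal +
  assumes proper: "carrier R \<noteq> I"
    and maximal: "\<lbrakk>left_ideal J R; I \<subseteq> J\<rbrakk> \<Longrightarrow> J = I \<or> J = carrier R"

text \<open>Intersecting with the carrier makes the radical of the zero ring, which has no maximal left
  ideals, the whole ring.\<close>

definition jacobson_radical :: "('a, 'b) ring_scheme \<Rightarrow> 'a set" where
  "jacobson_radical R = carrier R \<inter> \<Inter>{I. maximal_left_ideal I R}"


section \<open>Generalized t-fine rings\<close>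

definition nilpotents :: "('a, 'b) ring_scheme \<Rightarrow> 'a set" where
  "nilpotents R = {x \<in> carrier R. \<exists>m::nat. m \<ge> 1 \<and> x [^]\<^bsub>R\<^esub> m = \<zero>\<^bsub>R\<^esub>}"

definition torsion_units :: "('a, 'b) ring_scheme \<Rightarrow> 'a set" where
  "torsion_units R = {u \<in> Units R. \<exists>m::nat. m \<ge> 1 \<and> u [^]\<^bsub>R\<^esub> m = \<one>\<^bsub>R\<^esub>}"

definition generalized_t_fine :: "('a, 'b) ring_scheme \<Rightarrow> bool" where
  "generalized_t_fine R \<longleftrightarrow>
     ring R \<and> carrier R - jacobson_radical R = torsion_units R <+>\<^bsub>R\<^esub> nilpotents R"


section \<open>The endomorphism ring of an abelian group\<close>

text \<open>The abelian group is written multiplicatively, so the sum of two endomorphisms is their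
  pointwise product. Endomorphisms are taken to be extensional, so that two of them are equal as
  soon as they agree on the carrier.\<close>

definition endo_ring :: "('a, 'b) monoid_scheme \<Rightarrow> ('a \<Rightarrow> 'a) ring" where
  "endo_ring G =
     \<lparr>carrier = hom G G \<inter> extensional (carrier G),
      monoid.mult = compose (carrier G),
      monoid.one = (\<lambda>x\<in>carrier G. x),
      ring.zero = (\<lambda>x\<in>carrier G. \<one>\<^bsub>G\<^esub>),
      ring.add = (\<lambda>f g. \<lambda>x\<in>carrier G. f x \<otimes>\<^bsub>G\<^esub> g x)\<rparr>"

lemma endo_ring_simps:
  "carrier (endo_ring G) = hom G G \<inter> extensional (carrier G)"
  "monoid.mult (endo_ring G) = compose (carrier G)"
  "monoid.one (endo_ring G) = (\<lambda>x\<in>carrier G. x)"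
  "ring.zero (endo_ring G) = (\<lambda>x\<in>carrier G. \<one>\<^bsub>G\<^esub>)"
  "ring.add (endo_ring G) = (\<lambda>f g. \<lambda>x\<in>carrier G. f x \<otimes>\<^bsub>G\<^esub> g x)"
  by (simp_all add: endo_ring_def)

lemma ring_endo_ring:
  fixes G (structure)
  assumes "comm_group G"
  shows "ring (endo_ring G)"
proof -
  interpret comm_group G by fact
  have hc: "f x \<in> carrier G" if "f \<in> hom G G" "x \<in> carrier G" for f x
    using that by (auto simp: hom_def)
  have hm: "f (x \<otimes> y) = f x \<otimes> f y"
    if "f \<in> hom G G" "x \<in> carrier G" "y \<in> carrier G" for f x y
    using that by (auto simp: hom_def)
  show ?thesis
  proof (rule ringI)
    show "abelian_group (endo_ring G)"
    proof (rule abelian_groupI)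
      fix f assume f: "f \<in> carrier (endo_ring G)"
      show "\<exists>g\<in>carrier (endo_ring G). g \<oplus>\<^bsub>endo_ring G\<^esub> f = \<zero>\<^bsub>endo_ring G\<^esub>"
      proof
        show "(\<lambda>x\<in>carrier G. inv (f x)) \<in> carrier (endo_ring G)"
          using f by (auto simp: endo_ring_simps hom_def Pi_iff inv_mult)
        show "(\<lambda>x\<in>carrier G. inv (f x)) \<oplus>\<^bsub>endo_ring G\<^esub> f = \<zero>\<^bsub>endo_ring G\<^esub>"
          using f by (auto simp: endo_ring_simps hc intro!: restrict_ext)
      qed
    qed (auto simp: endo_ring_simps hom_def Pi_iff m_ac restrict_def extensional_def fun_eq_iff)
    show "monoid (endo_ring G)"
      by (rule monoidI)
        (auto simp: endo_ring_simps hom_def Pi_iff compose_def restrict_def extensional_def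
          fun_eq_iff)
  qed (auto simp: endo_ring_simps hc hm compose_def restrict_def fun_eq_iff)
qed

end

theory Submission
  imports Defs
begin

text \<open>Modulo a proper two-sided ideal, a unit plus a nilpotent is never zero, so in a generalized
  \<open>t\<close>-fine ring every proper two-sided ideal lies in the Jacobson radical. Applied to the ideals of
  endomorphisms that map one fully invariant subgroup into a smaller one, this forces the exponent
  of \<open>G\<close> to be a prime power \<open>p\<^sup>l\<^sup>+\<^sup>1\<close> and every element of order \<open>p\<close> to be a \<open>p\<^sup>l\<close>-th power, which
  means that \<open>G\<close> is free over \<open>\<int>/p\<^sup>l\<^sup>+\<^sup>1\<close>.

  Conversely, let \<open>A\<close> be an endomorphism of such a group. If some \<open>s\<close> of order \<open>p\<close> has
  \<open>A s \<notin> \<langle>s\<rangle>\<close>, then there is a basis \<open>v, \<dots>, w\<close> with \<open>A v = w\<close>, and in this basis a strictly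
  upper triangular endomorphism can be split off \<open>A\<close> leaving a unit. Otherwise \<open>A\<close> either kills all
  elements of order \<open>p\<close>, and lies in the radical, or it is injective.\<close>

section \<open>Jacobson radical and units of finite rings\<close>

lemma (in ring) left_ideal_principal:
  assumes "a \<in> carrier R"
  shows "left_ideal ((\<lambda>r. r \<otimes> a) ` carrier R) R"
proof -
  have "subgroup ((\<lambda>r. r \<otimes> a) ` carrier R) (add_monoid R)"
  proof (rule add.subgroupI)
    fix x assume "x \<in> (\<lambda>r. r \<otimes> a) ` carrier R"
    then obtain r where r: "r \<in> carrier R" "x = r \<otimes> a" by auto
    have "\<ominus> x = (\<ominus> r) \<otimes> a" using r assms by (simp add: l_minus)
    then show "\<ominus> x \<in> (\<lambda>r. r \<otimes> a) ` carrier R" using r by blast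
    fix y assume "y \<in> (\<lambda>r. r \<otimes> a) ` carrier R"
    then obtain s where s: "s \<in> carrier R" "y = s \<otimes> a" by auto
    have "x \<oplus> y = (r \<oplus> s) \<otimes> a" using r s assms by (simp add: l_distr)
    then show "x \<oplus> y \<in> (\<lambda>r. r \<otimes> a) ` carrier R" using r s by blast
  qed (use assms in auto)
  moreover have "x \<otimes> (r \<otimes> a) \<in> (\<lambda>r. r \<otimes> a) ` carrier R"
    if "x \<in> carrier R" "r \<in> carrier R" for x r
    using that assms by (auto simp: m_assoc[symmetric])
  ultimately show ?thesis
    by (intro left_ideal.intro additive_subgroup.intro left_ideal_axioms.intro ring_axioms) auto
qed

lemma (in ring) left_ideal_add:
  assumes "left_ideal I R" "left_ideal J R"
  shows "left_ideal (I <+>\<^bsub>R\<^esub> J) R"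
proof -
  interpret I: left_ideal I R by fact
  interpret J: left_ideal J R by fact
  have "additive_subgroup (I <+>\<^bsub>R\<^esub> J) R"
    by (rule add_additive_subgroups) unfold_locales
  moreover have "x \<otimes> a \<in> I <+>\<^bsub>R\<^esub> J" if x: "x \<in> carrier R" and a: "a \<in> I <+>\<^bsub>R\<^esub> J" for x a
  proof -
    obtain i j where ij: "i \<in> I" "j \<in> J" "a = i \<oplus> j" using a unfolding set_add_def' by blast
    then have "x \<otimes> a = x \<otimes> i \<oplus> x \<otimes> j"
      using x I.a_subset J.a_subset by (simp add: r_distr subset_iff)
    then show ?thesis
      using I.left_closed[OF ij(1) x] J.left_closed[OF ij(2) x] unfolding set_add_def' by blast
  qed
  ultimately show ?thesis
    by (simp add: left_ideal.intro left_ideal_axioms.intro ring_axioms)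
qed

lemma (in ring) left_ideal_one_imp_carrier:
  assumes "left_ideal I R" "\<one> \<in> I"
  shows "I = carrier R"
proof -
  interpret I: left_ideal I R by fact
  show ?thesis
    using I.left_closed[OF assms(2)] I.a_subset by auto
qed

text \<open>Finiteness stands in for Zorn's lemma: among the finitely many proper left ideals above
  \<open>I\<close> one is maximal under inclusion.\<close>

lemma (in ring) exists_maximal_left_ideal:
  assumes fin: "finite (carrier R)" and I: "left_ideal I R" "I \<noteq> carrier R"
  shows "\<exists>M. maximal_left_ideal M R \<and> I \<subseteq> M"
proof -
  define A where "A = {J. left_ideal J R \<and> J \<noteq> carrier R \<and> I \<subseteq> J}"
  have sub: "J \<subseteq> carrier R" if "left_ideal J R" for J
    using that additive_subgroup.a_subset left_ideal.axioms(1) by blast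
  have "A \<subseteq> Pow (carrier R)" using sub by (auto simp: A_def)
  then have "finite A" using fin finite_subset by auto
  moreover have "I \<in> A" using I by (auto simp: A_def)
  ultimately obtain M where M: "M \<in> A" "\<And>J. J \<in> A \<Longrightarrow> M \<subseteq> J \<Longrightarrow> M = J"
    using finite_has_maximal2[of A I] by (metis)
  have "maximal_left_ideal M R"
    using M by (auto intro!: maximal_left_ideal.intro maximal_left_ideal_axioms.intro simp: A_def)
  then show ?thesis using M by (auto simp: A_def)
qed

lemma (in ring) jacobson_radical_left_closed:
  assumes "f \<in> jacobson_radical R" "g \<in> carrier R"
  shows "g \<otimes> f \<in> jacobson_radical R"
  using assms left_ideal.left_closed maximal_left_ideal.axioms(1)
  by (fastforce simp: jacobson_radical_def)

text \<open>If the left ideal generated by \<open>\<one> \<ominus> f\<close> were proper, some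
  maximal left ideal would contain both it and \<open>f\<close>, hence
  \<open>\<one>\<close>.\<close>

lemma (in ring) jacobson_radical_left_inverse:
  assumes fin: "finite (carrier R)" and f: "f \<in> jacobson_radical R"
  shows "\<exists>g\<in>carrier R. g \<otimes> (\<one> \<ominus> f) = \<one>"
proof (rule ccontr)
  assume no: "\<not> ?thesis"
  have fR: "f \<in> carrier R" using f by (simp add: jacobson_radical_def)
  let ?I = "(\<lambda>r. r \<otimes> (\<one> \<ominus> f)) ` carrier R"
  have "left_ideal ?I R" using fR by (intro left_ideal_principal) simp
  moreover have "\<one> \<notin> ?I"
  proof
    assume "\<one> \<in> ?I"
    then obtain g where "g \<in> carrier R" "\<one> = g \<otimes> (\<one> \<ominus> f)" by blast
    then show False using no by metis
  qed
  ultimately obtain M where M: "maximal_left_ideal M R" "?I \<subseteq> M"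
    using exists_maximal_left_ideal[OF fin, of ?I] by (metis one_closed)
  interpret M: maximal_left_ideal M R by fact
  have "\<one> \<otimes> (\<one> \<ominus> f) \<in> M" using M(2) by blast
  then have "\<one> \<ominus> f \<in> M" using fR by simp
  moreover have "f \<in> M" using f M(1) by (auto simp: jacobson_radical_def)
  ultimately have "(\<one> \<ominus> f) \<oplus> f \<in> M" by (rule M.a_closed)
  then have "\<one> \<in> M" using fR by (simp add: minus_eq a_assoc l_neg)
  then show False
    using left_ideal_one_imp_carrier M.left_ideal_axioms M.proper by metis
qed

text \<open>A maximal left ideal that misses \<open>f\<close> is comaximal with the left ideal
  generated by \<open>f\<close>. It then contains some
  \<open>\<one> \<ominus> g \<otimes> f\<close>, whose left inverse puts \<open>\<one>\<close> into
  it.\<close>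

lemma (in ring) jacobson_radicalI:
  assumes f: "f \<in> carrier R"
    and inv: "\<And>g. g \<in> carrier R \<Longrightarrow> \<exists>h\<in>carrier R. h \<otimes> (\<one> \<ominus> g \<otimes> f) = \<one>"
  shows "f \<in> jacobson_radical R"
proof -
  have "f \<in> M" if "maximal_left_ideal M R" for M
  proof (rule ccontr)
    assume "f \<notin> M"
    interpret M: maximal_left_ideal M R by fact
    let ?P = "(\<lambda>r. r \<otimes> f) ` carrier R"
    have P: "left_ideal ?P R" using f by (rule left_ideal_principal)
    interpret P: left_ideal ?P R by (rule P)
    have "left_ideal (M <+>\<^bsub>R\<^esub> ?P) R"
      using left_ideal_add M.left_ideal_axioms P by blast
    moreover have "M \<subseteq> M <+>\<^bsub>R\<^esub> ?P"
      using P.zero_closed M.a_subset by (force simp: set_add_def')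
    moreover have "\<one> \<otimes> f \<in> ?P" by blast
    then have "\<zero> \<oplus> \<one> \<otimes> f \<in> M <+>\<^bsub>R\<^esub> ?P"
      using M.zero_closed unfolding set_add_def' by blast
    then have "f \<in> M <+>\<^bsub>R\<^esub> ?P" using f by simp
    ultimately have "M <+>\<^bsub>R\<^esub> ?P = carrier R"
      using M.maximal[of "M <+>\<^bsub>R\<^esub> ?P"] \<open>f \<notin> M\<close> by blast
    then have "\<one> \<in> M <+>\<^bsub>R\<^esub> ?P" by simp
    then obtain m g where m: "m \<in> M" "g \<in> carrier R" "\<one> = m \<oplus> g \<otimes> f"
      by (auto simp: set_add_def')
    then have mc: "m \<in> carrier R" using M.a_subset by auto
    have "m = \<one> \<ominus> g \<otimes> f"
      using m mc f by (simp add: minus_eq a_assoc r_neg)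
    then obtain h where "h \<in> carrier R" "h \<otimes> m = \<one>" using inv m by blast
    then have "\<one> \<in> M" using M.left_closed[of m h] m by simp
    then show False
      using left_ideal_one_imp_carrier M.left_ideal_axioms M.proper by metis
  qed
  then show ?thesis using f by (auto simp: jacobson_radical_def)
qed

section \<open>Units of finite rings are torsion\<close>

lemma (in monoid) finite_unit_torsion:
  assumes "finite (carrier G)" "u \<in> Units G"
  shows "\<exists>m\<ge>1::nat. u [^] m = \<one>"
proof -
  interpret U: group "units_of G" by (rule units_group)
  have fin: "finite (Units G)" using assms(1) by (rule finite_subset[rotated]) (auto simp: Units_def)
  have "u [^]\<^bsub>units_of G\<^esub> m = u [^] m" for m :: nat
    by (induction m) (auto simp: nat_pow_def units_of_def)
  then have "u [^] order (units_of G) = \<one>"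
    using U.pow_order_eq_1[of u] assms(2) by (simp add: units_of_carrier units_of_one)
  moreover have "order (units_of G) \<ge> 1"
    using U.order_gt_0_iff_finite fin by (simp add: units_of_carrier Suc_le_eq)
  ultimately show ?thesis by blast
qed

text \<open>This reduces generalized t-fineness of a finite ring to decompositions into a unit and a
  nilpotent.\<close>

lemma torsion_units_finite_ring:
  assumes "ring R" "finite (carrier R)"
  shows "torsion_units R = Units R"
  using monoid.finite_unit_torsion[of R] ring.is_monoid[OF assms(1)] assms(2)
  unfolding torsion_units_def by blast

section \<open>Endomorphisms of finite abelian groups\<close>

context comm_group
begin

lemma ring_endo: "ring (endo_ring G)"
  by (rule ring_endo_ring) (rule comm_group_axioms)

lemma endo_iff: "f \<in> carrier (endo_ring G) \<longleftrightarrow> f \<in> hom G G \<and> f \<in> extensional (carrier G)"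
  by (simp add: endo_ring_simps)

lemma endo_group_hom: "f \<in> carrier (endo_ring G) \<Longrightarrow> group_hom G G f"
  by (simp add: endo_iff group_hom_def group_hom_axioms_def)

lemma endo_eqI:
  "f \<in> carrier (endo_ring G) \<Longrightarrow> g \<in> carrier (endo_ring G) \<Longrightarrow> (\<And>x. x \<in> carrier G \<Longrightarrow> f x = g x) \<Longrightarrow> f = g"
  by (rule extensionalityI[of f "carrier G" g]) (simp_all add: endo_iff)

lemma restrict_in_endo:
  assumes "h \<in> hom G G"
  shows "restrict h (carrier G) \<in> carrier (endo_ring G)"
  using assms by (auto simp: endo_iff hom_def)

lemma endo_closed [simp]:
  "f \<in> carrier (endo_ring G) \<Longrightarrow> x \<in> carrier G \<Longrightarrow> f x \<in> carrier G"
  by (rule group_hom.hom_closed[OF endo_group_hom])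

lemma endo_mult_hom:
  "f \<in> carrier (endo_ring G) \<Longrightarrow> x \<in> carrier G \<Longrightarrow> y \<in> carrier G \<Longrightarrow> f (x \<otimes> y) = f x \<otimes> f y"
  by (rule group_hom.hom_mult[OF endo_group_hom])

lemma endo_one_hom [simp]: "f \<in> carrier (endo_ring G) \<Longrightarrow> f \<one> = \<one>"
  by (rule group_hom.hom_one[OF endo_group_hom])

lemma endo_inv_hom:
  "f \<in> carrier (endo_ring G) \<Longrightarrow> x \<in> carrier G \<Longrightarrow> f (inv x) = inv (f x)"
  by (rule group_hom.hom_inv[OF endo_group_hom])

lemma endo_nat_pow_hom:
  "f \<in> carrier (endo_ring G) \<Longrightarrow> x \<in> carrier G \<Longrightarrow> f (x [^] (n::nat)) = f x [^] n"
  by (rule group_hom.hom_nat_pow[OF endo_group_hom])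

lemma endo_int_pow_hom:
  "f \<in> carrier (endo_ring G) \<Longrightarrow> x \<in> carrier G \<Longrightarrow> f (x [^] (n::int)) = f x [^] n"
  by (rule group_hom.hom_int_pow[OF endo_group_hom])

lemma endo_add_apply [simp]: "x \<in> carrier G \<Longrightarrow> (f \<oplus>\<^bsub>endo_ring G\<^esub> g) x = f x \<otimes> g x"
  by (simp add: endo_ring_simps)

lemma endo_mult_apply [simp]: "x \<in> carrier G \<Longrightarrow> (f \<otimes>\<^bsub>endo_ring G\<^esub> g) x = f (g x)"
  by (simp add: endo_ring_simps compose_def)

lemma endo_one_apply [simp]: "x \<in> carrier G \<Longrightarrow> \<one>\<^bsub>endo_ring G\<^esub> x = x"
  by (simp add: endo_ring_simps)

lemma endo_zero_apply [simp]: "x \<in> carrier G \<Longrightarrow> \<zero>\<^bsub>endo_ring G\<^esub> x = \<one>"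
  by (simp add: endo_ring_simps)

lemma endo_minus_apply:
  assumes "f \<in> carrier (endo_ring G)" "g \<in> carrier (endo_ring G)" "x \<in> carrier G"
  shows "(f \<ominus>\<^bsub>endo_ring G\<^esub> g) x = f x \<otimes> inv (g x)"
proof -
  interpret R: ring "endo_ring G" by (rule ring_endo)
  have "(f \<ominus>\<^bsub>endo_ring G\<^esub> g) \<oplus>\<^bsub>endo_ring G\<^esub> g = f"
    using assms by (simp add: R.minus_eq R.a_assoc R.l_neg)
  then have "(f \<ominus>\<^bsub>endo_ring G\<^esub> g) x \<otimes> g x = f x"
    using assms(3) by (metis endo_add_apply)
  then show ?thesis
    using assms by (metis R.minus_closed endo_closed inv_solve_right)
qed

lemma endo_pow_apply:
  assumes "f \<in> carrier (endo_ring G)" "x \<in> carrier G"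
  shows "(f [^]\<^bsub>endo_ring G\<^esub> (m::nat)) x = (f ^^ m) x"
proof (induction m)
  case 0
  then show ?case using assms by simp
next
  case (Suc m)
  interpret R: ring "endo_ring G" by (rule ring_endo)
  show ?case using assms Suc R.nat_pow_Suc2[of f m] by simp
qed

lemma endo_in_nilpotentsI:
  assumes "f \<in> carrier (endo_ring G)" "\<And>x. x \<in> carrier G \<Longrightarrow> (f ^^ m) x = \<one>"
  shows "f \<in> nilpotents (endo_ring G)"
proof -
  interpret R: ring "endo_ring G" by (rule ring_endo)
  have "f [^]\<^bsub>endo_ring G\<^esub> Suc m = \<zero>\<^bsub>endo_ring G\<^esub>"
    by (rule endo_eqI) (use assms in \<open>simp_all add: endo_pow_apply\<close>)
  then show ?thesis using assms(1) unfolding nilpotents_def by fastforce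
qed

text \<open>The iterates of \<open>t\<close> under \<open>n\<close> stay in \<open>T\<close> and
  reach \<open>\<one> \<in> S\<close>, so at some point they enter \<open>S\<close>. With
  \<open>S = {\<one>}\<close> this produces a nontrivial kernel element; with a larger
  \<open>S\<close> it is the same argument modulo \<open>S\<close>.\<close>

lemma nilpotent_endo_leaves:
  assumes n: "n \<in> nilpotents (endo_ring G)"
    and T: "T \<subseteq> carrier G" "n ` T \<subseteq> T" and S: "\<one> \<in> S" and t: "t \<in> T" "t \<notin> S"
  shows "\<exists>x\<in>T. x \<notin> S \<and> n x \<in> S"
proof (rule ccontr)
  assume no: "\<not> ?thesis"
  have it: "(n ^^ m) t \<in> T \<and> (n ^^ m) t \<notin> S" for m
    using no T t by (induction m) auto
  obtain m :: nat where "n \<in> carrier (endo_ring G)" "n [^]\<^bsub>endo_ring G\<^esub> m = \<zero>\<^bsub>endo_ring G\<^esub>"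
    using n by (auto simp: nilpotents_def)
  then have "(n ^^ m) t = \<one>"
    using endo_pow_apply[of n t m] t T by auto
  then show False using it[of m] S by auto
qed

lemma unit_endo_inverse:
  assumes "u \<in> Units (endo_ring G)"
  obtains v where "v \<in> carrier (endo_ring G)" "\<And>x. x \<in> carrier G \<Longrightarrow> v (u x) = x"
proof -
  obtain v where v: "v \<in> carrier (endo_ring G)" "v \<otimes>\<^bsub>endo_ring G\<^esub> u = \<one>\<^bsub>endo_ring G\<^esub>"
    using assms by (auto simp: Units_def)
  have "v (u x) = x" if "x \<in> carrier G" for x
    using v(2) that by (metis endo_mult_apply endo_one_apply)
  then show ?thesis using v that by blast
qed

end

locale finite_comm_group = comm_group +
  assumes finite_carrier: "finite (carrier G)"
begin

lemma finite_endo: "finite (carrier (endo_ring G))"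
proof (rule finite_subset)
  show "carrier (endo_ring G) \<subseteq> carrier G \<rightarrow>\<^sub>E carrier G"
    unfolding endo_ring_simps hom_def PiE_def by blast
  show "finite (carrier G \<rightarrow>\<^sub>E carrier G)"
    using finite_carrier by (simp add: finite_PiE)
qed

lemma surj_endo_in_Units:
  assumes f: "f \<in> carrier (endo_ring G)" "carrier G \<subseteq> f ` carrier G"
  shows "f \<in> Units (endo_ring G)"
proof -
  have surj: "f ` carrier G = carrier G" using f by auto
  then have "inj_on f (carrier G)" by (simp add: finite_carrier eq_card_imp_inj_on)
  then have iso: "f \<in> iso G G"
    using f(1) surj unfolding iso_def bij_betw_def endo_iff by blast
  define g where "g = restrict (inv_into (carrier G) f) (carrier G)"
  have "inv_into (carrier G) f \<in> hom G G"
    using iso_set_sym[OF iso] by (simp add: iso_def)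
  then have g: "g \<in> carrier (endo_ring G)" unfolding g_def by (rule restrict_in_endo)
  interpret R: ring "endo_ring G" by (rule ring_endo)
  have "g \<otimes>\<^bsub>endo_ring G\<^esub> f = \<one>\<^bsub>endo_ring G\<^esub>" "f \<otimes>\<^bsub>endo_ring G\<^esub> g = \<one>\<^bsub>endo_ring G\<^esub>"
    using f g \<open>inj_on f _\<close> surj
    by (auto intro!: endo_eqI R.m_closed simp: g_def inv_into_f_f f_inv_into_f simp del: R.m_closed)
  then show ?thesis using f g by (auto simp: Units_def)
qed

lemma inj_endo_in_Units:
  assumes f: "f \<in> carrier (endo_ring G)" "\<And>x. x \<in> carrier G \<Longrightarrow> f x = \<one> \<Longrightarrow> x = \<one>"
  shows "f \<in> Units (endo_ring G)"
proof (rule surj_endo_in_Units)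
  interpret group_hom G G f using f(1) by (rule endo_group_hom)
  have "inj_on f (carrier G)" using f(2) inj_on_one_iff by auto
  then show "carrier G \<subseteq> f ` carrier G"
    using endo_inj_surj[OF finite_carrier, of f] f(1) by (simp add: image_subset_iff)
qed (rule f)

text \<open>The difference of the identity and \<open>f\<close> kills every fixed point of
  \<open>f\<close>, yet it has a left inverse.\<close>

lemma jacobson_radical_fixed_point:
  assumes f: "f \<in> jacobson_radical (endo_ring G)" and x: "x \<in> carrier G" "f x = x"
  shows "x = \<one>"
proof -
  interpret R: ring "endo_ring G" by (rule ring_endo)
  have fc: "f \<in> carrier (endo_ring G)" using f by (simp add: jacobson_radical_def)
  obtain g where g: "g \<in> carrier (endo_ring G)"
    "g \<otimes>\<^bsub>endo_ring G\<^esub> (\<one>\<^bsub>endo_ring G\<^esub> \<ominus>\<^bsub>endo_ring G\<^esub> f) = \<one>\<^bsub>endo_ring G\<^esub>"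
    using R.jacobson_radical_left_inverse[OF finite_endo f] by blast
  have "x = g ((\<one>\<^bsub>endo_ring G\<^esub> \<ominus>\<^bsub>endo_ring G\<^esub> f) x)"
    using g(2) x(1) by (metis endo_mult_apply endo_one_apply)
  also have "(\<one>\<^bsub>endo_ring G\<^esub> \<ominus>\<^bsub>endo_ring G\<^esub> f) x = \<one>"
    using fc x by (simp add: endo_minus_apply)
  finally show ?thesis using g(1) by simp
qed

text \<open>A kernel element of the identity minus \<open>g f\<close> is a fixed point of
  \<open>g f\<close>. Without nontrivial fixed points the difference is injective, hence a unit by
  finiteness, and the criterion \<open>jacobson_radicalI\<close> applies.\<close>

lemma endo_in_jacobson_radicalI:
  assumes f: "f \<in> carrier (endo_ring G)"
    and fix1: "\<And>g x. g \<in> carrier (endo_ring G) \<Longrightarrow> x \<in> carrier G \<Longrightarrow> g (f x) = x \<Longrightarrow> x = \<one>"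
  shows "f \<in> jacobson_radical (endo_ring G)"
proof -
  interpret R: ring "endo_ring G" by (rule ring_endo)
  show ?thesis
  proof (rule R.jacobson_radicalI[OF f])
    fix g assume g: "g \<in> carrier (endo_ring G)"
    let ?h = "\<one>\<^bsub>endo_ring G\<^esub> \<ominus>\<^bsub>endo_ring G\<^esub> g \<otimes>\<^bsub>endo_ring G\<^esub> f"
    have "x = \<one>" if x: "x \<in> carrier G" "?h x = \<one>" for x
    proof -
      have "x \<otimes> inv (g (f x)) = \<one>" using x f g by (simp add: endo_minus_apply)
      then have "g (f x) = x" using x f g by (metis endo_closed inv_equality inv_inv inv_closed)
      then show ?thesis using fix1 g x by blast
    qed
    then have "?h \<in> Units (endo_ring G)" using f g by (intro inj_endo_in_Units) auto
    then show "\<exists>h\<in>carrier (endo_ring G). h \<otimes>\<^bsub>endo_ring G\<^esub> ?h = \<one>\<^bsub>endo_ring G\<^esub>"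
      by (auto simp: Units_def)
  qed
qed

lemma generalized_t_fine_endo_iff:
  "generalized_t_fine (endo_ring G) \<longleftrightarrow>
     carrier (endo_ring G) - jacobson_radical (endo_ring G) =
     {u \<oplus>\<^bsub>endo_ring G\<^esub> n |u n. u \<in> Units (endo_ring G) \<and> n \<in> nilpotents (endo_ring G)}"
proof -
  have "Units (endo_ring G) <+>\<^bsub>endo_ring G\<^esub> nilpotents (endo_ring G) =
     {u \<oplus>\<^bsub>endo_ring G\<^esub> n |u n. u \<in> Units (endo_ring G) \<and> n \<in> nilpotents (endo_ring G)}"
    unfolding set_add_def' by blast
  then show ?thesis
    by (simp add: generalized_t_fine_def ring_endo torsion_units_finite_ring[OF ring_endo finite_endo])
qed

text \<open>On a nontrivial \<open>x\<close> killed by \<open>n\<close> the sum acts as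
  \<open>u\<close>. Composing with the inverse \<open>v\<close> of \<open>u\<close> gives an element
  of the same left ideal that fixes \<open>x\<close>, which the radical forbids.\<close>

lemma unit_plus_nilpotent_notin_jacobson_radical:
  assumes nontriv: "carrier G \<noteq> {\<one>}"
    and u: "u \<in> Units (endo_ring G)" and n: "n \<in> nilpotents (endo_ring G)"
  shows "u \<oplus>\<^bsub>endo_ring G\<^esub> n \<notin> jacobson_radical (endo_ring G)"
proof
  assume J: "u \<oplus>\<^bsub>endo_ring G\<^esub> n \<in> jacobson_radical (endo_ring G)"
  interpret R: ring "endo_ring G" by (rule ring_endo)
  have nc: "n \<in> carrier (endo_ring G)" using n by (simp add: nilpotents_def)
  have uc: "u \<in> carrier (endo_ring G)" using u by blast
  obtain t where "t \<in> carrier G" "t \<noteq> \<one>" using nontriv by blast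
  then obtain x where x: "x \<in> carrier G" "x \<noteq> \<one>" "n x = \<one>"
    using nilpotent_endo_leaves[OF n, of "carrier G" "{\<one>}" t] nc
    by (auto simp: image_subset_iff)
  obtain v where v: "v \<in> carrier (endo_ring G)" "v (u x) = x"
    using unit_endo_inverse[OF u] x(1) by metis
  have "(v \<otimes>\<^bsub>endo_ring G\<^esub> (u \<oplus>\<^bsub>endo_ring G\<^esub> n)) x = x"
    using x v uc by simp
  then show False
    using jacobson_radical_fixed_point R.jacobson_radical_left_closed[OF J v(1)] x by blast
qed

text \<open>The fixed point \<open>x\<close> only serves to keep \<open>f\<close>, an element of the two-sided ideal of maps
  \<open>T \<rightarrow> S\<close>, outside the radical.\<close>

lemma t_fine_fully_invariant:
  assumes tf: "generalized_t_fine (endo_ring G)"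
    and T: "T \<subseteq> carrier G" and S: "subgroup S G"
    and invT: "\<And>h. h \<in> carrier (endo_ring G) \<Longrightarrow> h ` T \<subseteq> T"
    and invS: "\<And>h. h \<in> carrier (endo_ring G) \<Longrightarrow> h ` S \<subseteq> S"
    and f: "f \<in> carrier (endo_ring G)" "f ` T \<subseteq> S"
    and x: "x \<in> carrier G" "x \<noteq> \<one>" "f x = x"
  shows "T \<subseteq> S"
proof (rule ccontr)
  assume "\<not> T \<subseteq> S"
  then obtain t0 where t0: "t0 \<in> T" "t0 \<notin> S" by blast
  interpret S: subgroup S G by fact
  have "f \<notin> jacobson_radical (endo_ring G)"
    using jacobson_radical_fixed_point x by blast
  then obtain u n where un: "u \<in> Units (endo_ring G)" "n \<in> nilpotents (endo_ring G)"
    "f = u \<oplus>\<^bsub>endo_ring G\<^esub> n"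
    using tf f(1) unfolding generalized_t_fine_endo_iff by blast
  have nc: "n \<in> carrier (endo_ring G)" using un by (simp add: nilpotents_def)
  have uc: "u \<in> carrier (endo_ring G)" using un(1) by (simp add: Units_def)
  \<comment> \<open>Modulo \<open>S\<close> this \<open>t\<close> is killed by both \<open>f\<close>
    and \<open>n\<close>, so \<open>u t\<close> lies in \<open>S\<close>. The inverse of
    \<open>u\<close> also preserves \<open>S\<close> and brings \<open>t\<close> itself into
    \<open>S\<close>.\<close>
  obtain t where t: "t \<in> T" "t \<notin> S" "n t \<in> S"
    using nilpotent_endo_leaves[OF un(2) T invT[OF nc] S.one_closed t0] by blast
  have tG: "t \<in> carrier G" using t T by blast
  have "u t = f t \<otimes> inv (n t)"
    using tG un nc uc by (simp add: m_assoc)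
  then have "u t \<in> S" using t f(2) by auto
  obtain v where v: "v \<in> carrier (endo_ring G)" "v (u t) = t"
    using unit_endo_inverse[OF un(1)] tG by metis
  then have "t \<in> S" using invS[OF v(1)] \<open>u t \<in> S\<close> by force
  then show False using t by blast
qed

end

section \<open>Cyclic direct factors\<close>

lemma (in monoid) set_mult_memI: "h \<in> H \<Longrightarrow> k \<in> K \<Longrightarrow> h \<otimes> k \<in> H <#> K"
  unfolding set_mult_def by blast

text \<open>Modulo \<open>K\<close> the order of \<open>z\<close> divides \<open>p ^ Suc l\<close>
  but not \<open>p ^ l\<close>, so it is exactly \<open>p ^ Suc l\<close>. By Bezout the gcd of
  \<open>j\<close> and \<open>p ^ Suc l\<close> also carries \<open>z\<close> into \<open>K\<close>,
  so this power of \<open>p\<close> cannot have exponent at most \<open>l\<close>.\<close>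

lemma (in group) prime_power_dvd_exponent:
  assumes p: "Factorial_Ring.prime (p::nat)" and K: "subgroup K G" and z: "z \<in> carrier G"
    and "z [^] (p ^ Suc l) \<in> K" "z [^] (p ^ l) \<notin> K" "z [^] (j::int) \<in> K"
  shows "int (p ^ Suc l) dvd j"
proof -
  define d where "d = gcd (nat \<bar>j\<bar>) (p ^ Suc l)"
  obtain i where i: "i \<le> Suc l" "d = p ^ i"
    using divides_primepow_nat[OF p, of d "Suc l"] unfolding d_def by blast
  obtain u v where uv: "u * j + v * int (p ^ Suc l) = gcd j (int (p ^ Suc l))"
    using bezout_int by blast
  have d: "int d = gcd j (int (p ^ Suc l))"
    unfolding d_def gcd_int_int_eq[symmetric] by simp
  have "z [^] int d = (z [^] j) [^] u \<otimes> (z [^] int (p ^ Suc l)) [^] v"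
    unfolding d uv[symmetric] using z by (simp add: int_pow_pow int_pow_mult mult.commute)
  moreover have "(z [^] j) [^] u \<in> K" "(z [^] int (p ^ Suc l)) [^] v \<in> K"
    using subgroup_int_pow_closed[OF K] assms unfolding int_pow_int by blast+
  ultimately have "z [^] d \<in> K"
    using subgroup.m_closed[OF K] by (simp add: int_pow_int)
  moreover have "z [^] (p ^ l) = (z [^] d) [^] int (p ^ (l - i))" if "i \<le> l"
    using z that i unfolding int_pow_int by (simp add: nat_pow_pow power_add[symmetric])
  ultimately have "i = Suc l"
    using i(1) assms(5) subgroup_int_pow_closed[OF K] le_SucE by metis
  then show ?thesis using d i by (metis gcd_dvd1)
qed

text \<open>A cyclic subgroup whose order equals the exponent of a finite abelian
  \<open>p\<close>-group is a direct factor. The retraction is the projection along a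
  complement.\<close>

lemma (in finite_comm_group) cyclic_retract:
  assumes p: "Factorial_Ring.prime (p::nat)"
    and exp: "\<And>y. y \<in> carrier G \<Longrightarrow> y [^] (p ^ Suc l) = \<one>"
    and x: "x \<in> carrier G" "x [^] (p ^ l) \<noteq> \<one>"
  shows "\<exists>f\<in>carrier (endo_ring G). f x = x \<and> f ` carrier G \<subseteq> range (\<lambda>i::int. x [^] i)"
proof -
  define C where "C = range (\<lambda>i::int. x [^] i)"
  have C: "subgroup C G" unfolding C_def using x(1) by (rule subgroup_of_powers)
  interpret C: subgroup C G by (rule C)
  have xC: "x \<in> C" unfolding C_def using x(1) int_pow_1 by (metis rangeI)
  \<comment> \<open>The complement will be a maximal member \<open>K\<close> of this family;
    maximality must be shown to force \<open>K <#> C\<close> to be everything.\<close>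
  define A where "A = {K. subgroup K G \<and> K \<inter> C = {\<one>}}"
  have "A \<subseteq> Pow (carrier G)" by (auto simp: A_def dest: subgroup.subset)
  then have "finite A" using finite_carrier finite_subset by auto
  moreover have "{\<one>} \<in> A" using C.one_closed triv_subgroup by (auto simp: A_def)
  ultimately obtain K where KA: "K \<in> A" and Kmax: "\<And>L. L \<in> A \<Longrightarrow> K \<subseteq> L \<Longrightarrow> K = L"
    using finite_has_maximal2[of A "{\<one>}"] by metis
  have K: "subgroup K G" and KC: "K \<inter> C = {\<one>}" using KA by (auto simp: A_def)
  interpret K: subgroup K G by (rule K)
  interpret W: subgroup "K <#> C" G by (rule mult_subgroups[OF K C])
  have KW: "k \<in> K <#> C" if "k \<in> K" for k
    using set_mult_memI[OF that C.one_closed] that by simp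
  have CW: "k \<in> K <#> C" if "k \<in> C" for k
    using set_mult_memI[OF K.one_closed that] that by simp
  have gen: "carrier G \<subseteq> K <#> C"
  proof (rule ccontr)
    assume "\<not> carrier G \<subseteq> K <#> C"
    then obtain y0 where y0: "y0 \<in> carrier G" "y0 \<notin> K <#> C" by blast
    \<comment> \<open>Stopping one step before the \<open>p\<close>-power iterates of
      \<open>y0\<close> enter \<open>K <#> C\<close> gives an element \<open>y\<close> outside whose
      \<open>p\<close>-th power is inside.\<close>
    define m where "m = (LEAST m. y0 [^] (p ^ m) \<in> K <#> C)"
    have ex: "y0 [^] (p ^ Suc l) \<in> K <#> C" using W.one_closed unfolding exp[OF y0(1)] .
    have m: "y0 [^] (p ^ m) \<in> K <#> C" unfolding m_def by (rule LeastI[where P = "\<lambda>m. y0 [^] (p ^ m) \<in> K <#> C", OF ex])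
    have "m \<noteq> 0" using m y0 by (metis nat_pow_eone power_0)
    then obtain m' where m': "m = Suc m'" using not0_implies_Suc by blast
    define y where "y = y0 [^] (p ^ m')"
    have y: "y \<in> carrier G" "y \<notin> K <#> C" "y [^] p \<in> K <#> C"
      using y0 m not_less_Least[of m' "\<lambda>m. y0 [^] (p ^ m) \<in> K <#> C"]
      by (auto simp: y_def m' m_def[symmetric] nat_pow_pow mult.commute)
    obtain c i where c: "c \<in> K" "y [^] p = c \<otimes> x [^] (i::int)"
      using y(3) by (auto simp: set_mult_def C_def)
    have cG: "c \<in> carrier G" using c K.subset by blast
    \<comment> \<open>Since the exponent of the group is no larger than the order of
      \<open>x\<close>, raising to \<open>p ^ l\<close> gives a relation that places
      \<open>x [^] (i * int (p ^ l))\<close> in \<open>K \<inter> C\<close>. It is therefore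
      trivial, and \<open>p\<close> divides \<open>i\<close>.\<close>
    have "\<one> = (y [^] p) [^] (p ^ l)" using exp[OF y(1)] y(1) by (simp add: nat_pow_pow)
    also have "\<dots> = c [^] (p ^ l) \<otimes> x [^] (i * int (p ^ l))"
      unfolding c(2) using cG x(1) by (simp add: int_pow_distrib int_pow_pow flip: int_pow_int)
    finally have "x [^] (i * int (p ^ l)) = inv (c [^] (p ^ l))"
      using cG x(1) by (metis inv_equality inv_inv int_pow_closed nat_pow_closed m_comm inv_closed)
    also have "\<dots> \<in> K" using subgroup_int_pow_closed[OF K c(1)] by (metis K.m_inv_closed int_pow_int)
    finally have "x [^] (i * int (p ^ l)) = \<one>" using KC by (auto simp: C_def)
    then have "int (p ^ Suc l) dvd i * int (p ^ l)"
      using prime_power_dvd_exponent[OF p triv_subgroup x(1), of l "i * int (p ^ l)"] exp x by auto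
    then have "int p dvd i" using prime_gt_0_nat[OF p] by auto
    then obtain i' where i': "i = int p * i'" by (elim dvdE)
    \<comment> \<open>Dividing by a \<open>p\<close>-th root of the \<open>C\<close>-part of
      \<open>y [^] p\<close> leaves \<open>z\<close> outside \<open>K <#> C\<close> but moves its
      \<open>p\<close>-th power into \<open>K\<close>.\<close>
    define z where "z = y \<otimes> inv (x [^] i')"
    have zG: "z \<in> carrier G" using y x by (simp add: z_def)
    have xiC: "x [^] a \<in> C" for a :: int by (simp add: C_def)
    have "z [^] p = y [^] p \<otimes> inv (x [^] i)"
      using y(1) x(1) by (simp add: z_def i' int_pow_distrib int_pow_pow int_pow_inv mult.commute
          flip: int_pow_int)
    then have zp: "z [^] p \<in> K" using c cG x(1) by (simp add: m_assoc)
    have "y = z \<otimes> x [^] i'" using y x by (simp add: z_def m_assoc)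
    then have zW: "z \<notin> K <#> C" using y(2) CW xiC W.m_closed by blast
    \<comment> \<open>\<open>L\<close> properly contains \<open>K\<close>, so by maximality it meets
      \<open>C\<close> in some \<open>b = k \<otimes> z [^] j\<close> other than
      \<open>\<one>\<close>. Then \<open>z [^] j\<close> lies in \<open>K <#> C\<close>, which
      forces \<open>p\<close> to divide \<open>j\<close>, so \<open>b\<close> falls into
      \<open>K \<inter> C\<close> after all.\<close>
    define L where "L = K <#> range (\<lambda>j::int. z [^] j)"
    have L: "subgroup L G" unfolding L_def by (rule mult_subgroups[OF K subgroup_of_powers[OF zG]])
    have memL: "k \<otimes> z [^] j \<in> L" if "k \<in> K" for k and j :: int
      unfolding L_def using that by (intro set_mult_memI) auto
    have "z \<in> L" using memL[OF K.one_closed, of 1] zG by simp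
    moreover have "k \<in> L" if "k \<in> K" for k
      using memL[OF that, of 0] that by simp
    ultimately have "L \<notin> A" using Kmax[of L] zW KW by blast
    then obtain b where b: "b \<in> L" "b \<in> C" "b \<noteq> \<one>"
      using L C.one_closed subgroup.one_closed[OF L] by (auto simp: A_def)
    then obtain k j where kj: "k \<in> K" "b = k \<otimes> z [^] (j::int)" by (auto simp: L_def set_mult_def)
    have zj: "z [^] j = inv k \<otimes> b" using kj zG by (simp add: m_assoc[symmetric])
    then have "z [^] j \<in> K <#> C" using kj(1) b(2) by (auto simp: set_mult_def)
    moreover have "z [^] p \<in> K <#> C" using zp KW by blast
    ultimately have "int (p ^ Suc 0) dvd j"
      using zW zG by (intro prime_power_dvd_exponent[OF p W.subgroup_axioms zG]) auto
    then obtain j' where "j = int p * j'" by auto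
    then have "z [^] j = (z [^] p) [^] j'" using zG by (simp add: int_pow_pow flip: int_pow_int)
    then have "z [^] j \<in> K" using subgroup_int_pow_closed[OF K zp] by simp
    then have "b \<in> K" using kj by simp
    then show False using b KC by blast
  qed
  \<comment> \<open>The projection onto \<open>C\<close> along \<open>K\<close>: the
    \<open>C\<close>-component exists by \<open>gen\<close> and is unique because
    \<open>K \<inter> C\<close> is trivial.\<close>
  define f where "f = (\<lambda>g\<in>carrier G. THE h. h \<in> C \<and> g \<otimes> inv h \<in> K)"
  have fI: "f g = h" if g: "g \<in> carrier G" "h \<in> C" "g \<otimes> inv h \<in> K" for g h
  proof -
    have "h' = h" if h': "h' \<in> C" "g \<otimes> inv h' \<in> K" for h'
    proof -
      have [simp]: "h \<in> carrier G" "h' \<in> carrier G" using g h' C.subset by auto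
      have "inv (g \<otimes> inv h') \<otimes> (g \<otimes> inv h) = h' \<otimes> inv h"
      proof -
        have "inv (g \<otimes> inv h') \<otimes> (g \<otimes> inv h) = h' \<otimes> (inv g \<otimes> (g \<otimes> inv h))"
          using g(1) by (simp add: inv_mult m_ac)
        also have "\<dots> = h' \<otimes> inv h" using g(1) by (simp add: m_assoc[symmetric])
        finally show ?thesis .
      qed
      then have "h' \<otimes> inv h \<in> K" using g h' by (metis K.m_closed K.m_inv_closed)
      moreover have "h' \<otimes> inv h \<in> C" using g h' by simp
      ultimately have "h' \<otimes> inv h = h \<otimes> inv h" using KC by auto
      then show ?thesis using right_cancel[of "inv h" h' h] by simp
    qed
    then have "(THE h. h \<in> C \<and> g \<otimes> inv h \<in> K) = h" using g by (intro the_equality) blast+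
    then show ?thesis using g(1) by (simp add: f_def)
  qed
  have ex: "\<exists>h\<in>C. g \<otimes> inv h \<in> K" if "g \<in> carrier G" for g
  proof -
    obtain k h where kh: "k \<in> K" "h \<in> C" "g = k \<otimes> h" using gen \<open>g \<in> carrier G\<close> by (auto simp: set_mult_def)
    then have "g \<otimes> inv h = k" using K.subset C.subset by (simp add: m_assoc subset_iff)
    then show ?thesis using kh by metis
  qed
  have fC: "f g \<in> C" "g \<otimes> inv (f g) \<in> K" if "g \<in> carrier G" for g
    using ex[OF that] fI[OF that] by auto
  have fG: "f g \<in> carrier G" if "g \<in> carrier G" for g using fC[OF that] C.subset by blast
  have "f (g \<otimes> h) = f g \<otimes> f h" if "g \<in> carrier G" "h \<in> carrier G" for g h
  proof (rule fI)
    have "g \<otimes> h \<otimes> inv (f g \<otimes> f h) = (g \<otimes> inv (f g)) \<otimes> (h \<otimes> inv (f h))"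
      using that fG by (simp add: inv_mult m_ac)
    then show "g \<otimes> h \<otimes> inv (f g \<otimes> f h) \<in> K" using fC that by simp
  qed (use that fC in auto)
  then have "f \<in> hom G G" using fG by (intro homI) auto
  moreover have "f \<in> extensional (carrier G)" unfolding f_def by (rule restrict_extensional)
  ultimately have "f \<in> carrier (endo_ring G)" unfolding endo_iff ..
  moreover have "f x = x" using fI[of x x] x xC by simp
  ultimately show ?thesis using fC unfolding C_def by blast
qed

section \<open>Homocyclic groups\<close>

text \<open>A basis-free form of being a nonzero free module over \<int>/p^(l+1). Using
  \<open>Suc l\<close> makes the exponent positive and leaves \<open>p ^ l\<close> as the power that
  maps onto the socle, the elements killed by \<open>p\<close>.\<close>

locale homocyclic_group = finite_comm_group G for G (structure) +
  fixes p l :: nat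
  assumes prime: "Factorial_Ring.prime p"
    and exponent: "x \<in> carrier G \<Longrightarrow> x [^] (p ^ Suc l) = \<one>"
    and socle_divisible: "\<lbrakk>x \<in> carrier G; x [^] p = \<one>\<rbrakk> \<Longrightarrow> \<exists>y\<in>carrier G. y [^] (p ^ l) = x"
    and nontrivial: "carrier G \<noteq> {\<one>}"

section \<open>Kernels and images of power maps, and what t-fineness forces on them\<close>

context finite_comm_group
begin

lemma pow_kernel_subgroup: "subgroup {x \<in> carrier G. x [^] (n::nat) = \<one>} G"
  by (rule subgroupI) (auto simp: nat_pow_distrib nat_pow_inv)

lemma pow_image_subgroup: "subgroup ((\<lambda>x. x [^] (n::nat)) ` carrier G) G"
proof (rule subgroupI)
  fix a b
  assume "a \<in> (\<lambda>x. x [^] n) ` carrier G"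
  then obtain x where x: "x \<in> carrier G" "a = x [^] n" by blast
  then have "inv a = (inv x) [^] n" by (simp add: nat_pow_inv)
  then show "inv a \<in> (\<lambda>x. x [^] n) ` carrier G" using x by blast
  assume "b \<in> (\<lambda>x. x [^] n) ` carrier G"
  then obtain y where y: "y \<in> carrier G" "b = y [^] n" by blast
  then have "a \<otimes> b = (x \<otimes> y) [^] n" using x by (simp add: nat_pow_distrib)
  then show "a \<otimes> b \<in> (\<lambda>x. x [^] n) ` carrier G" using x y by blast
qed auto

lemma endo_pow_kernel:
  "h \<in> carrier (endo_ring G) \<Longrightarrow>
    h ` {x \<in> carrier G. x [^] (n::nat) = \<one>} \<subseteq> {x \<in> carrier G. x [^] n = \<one>}"
  by (auto simp flip: endo_nat_pow_hom)

lemma endo_pow_image: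
  "h \<in> carrier (endo_ring G) \<Longrightarrow>
    h ` (\<lambda>x. x [^] (n::nat)) ` carrier G \<subseteq> (\<lambda>x. x [^] n) ` carrier G"
  by (auto simp: endo_nat_pow_hom)

text \<open>In the zero ring the radical is everything, whereas
  \<open>\<one> \<oplus> \<zero>\<close> is a unit plus a nilpotent and would have to lie outside
  it.\<close>

lemma t_fine_nontrivial:
  assumes "generalized_t_fine (endo_ring G)"
  shows "carrier G \<noteq> {\<one>}"
proof
  assume triv: "carrier G = {\<one>}"
  interpret R: ring "endo_ring G" by (rule ring_endo)
  have "\<zero>\<^bsub>endo_ring G\<^esub> \<in> nilpotents (endo_ring G)"
    by (rule endo_in_nilpotentsI[of _ 1]) auto
  then have "\<one>\<^bsub>endo_ring G\<^esub> \<oplus>\<^bsub>endo_ring G\<^esub> \<zero>\<^bsub>endo_ring G\<^esub> \<notin> jacobson_radical (endo_ring G)"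
    using assms unfolding generalized_t_fine_endo_iff by blast
  moreover have "f \<in> jacobson_radical (endo_ring G)" if "f \<in> carrier (endo_ring G)" for f
    using that triv by (intro endo_in_jacobson_radicalI) auto
  ultimately show False by blast
qed

text \<open>The exponent \<open>e\<close> splits as \<open>q * m\<close> with \<open>q\<close> its
  \<open>p\<close>-part. If \<open>m\<close> were not 1, the projection onto the
  \<open>m\<close>-torsion would have a nontrivial fixed point, and full invariance would make all
  of \<open>G\<close> \<open>m\<close>-torsion.\<close>

lemma t_fine_exponent_prime_power:
  assumes tf: "generalized_t_fine (endo_ring G)"
  obtains p l :: nat where "Factorial_Ring.prime p" "\<And>x. x \<in> carrier G \<Longrightarrow> x [^] (p ^ Suc l) = \<one>"
    "\<exists>x\<in>carrier G. x [^] (p ^ l) \<noteq> \<one>"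
proof -
  define e where "e = (LEAST e::nat. e \<ge> 1 \<and> (\<forall>x\<in>carrier G. x [^] e = \<one>))"
  have "order G \<ge> 1" using order_gt_0_iff_finite finite_carrier by (simp add: Suc_le_eq)
  then have "order G \<ge> 1 \<and> (\<forall>x\<in>carrier G. x [^] order G = \<one>)" using pow_order_eq_1 by blast
  then have "e \<ge> 1 \<and> (\<forall>x\<in>carrier G. x [^] e = \<one>)"
    unfolding e_def by (rule LeastI[where P = "\<lambda>e. e \<ge> 1 \<and> (\<forall>x\<in>carrier G. x [^] e = \<one>)"])
  then have e: "e \<ge> 1" "\<And>x. x \<in> carrier G \<Longrightarrow> x [^] e = \<one>" by auto
  have emin: "\<exists>x\<in>carrier G. x [^] k \<noteq> \<one>" if "1 \<le> k" "k < e" for k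
    using not_less_Least[of k "\<lambda>e. e \<ge> 1 \<and> (\<forall>x\<in>carrier G. x [^] e = \<one>)"] that e_def by auto
  have "e \<noteq> 1"
    using t_fine_nontrivial[OF tf] e(2) by auto
  then obtain p where p: "Factorial_Ring.prime p" "p dvd e" using prime_factor_nat by blast
  obtain m where m: "e = p ^ multiplicity p e * m" "\<not> p dvd m"
    using multiplicity_decompose'[of e p] e(1) p(1) by (metis not_one_le_zero not_prime_unit)
  define q where "q = p ^ multiplicity p e"
  have em: "e = q * m" using m by (simp add: q_def)
  have "multiplicity p e \<noteq> 0" using m p by (metis mult_1 power_0)
  then obtain l where l: "multiplicity p e = Suc l" using not0_implies_Suc by blast
  have p1: "p > 1" using p prime_gt_1_nat by blast
  have q1: "q > 1" unfolding q_def l by (rule one_less_power[OF p1]) simp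
  have "m = 1"
  proof (rule ccontr)
    assume "m \<noteq> 1"
    have "m \<noteq> 0" using em e(1) by (metis mult_0_right not_one_le_zero)
    with \<open>m \<noteq> 1\<close> have m2: "1 < m" by linarith
    have "1 * m < q * m" "q * 1 < q * m" using q1 m2 by (auto intro: mult_strict_right_mono mult_strict_left_mono)
    then have m1: "1 \<le> m" "m < e" "q < e" using em m2 by auto
    have "coprime m q" unfolding q_def using prime_imp_coprime[OF p(1) m(2)]
      by (metis coprime_commute coprime_power_left_iff)
    then obtain u v where uv: "u * int m + v * int q = 1"
      using bezout_int[of "int m" "int q"] by auto
    \<comment> \<open>The Bezout coefficient makes \<open>v * int q\<close> congruent to 1 modulo
      \<open>m\<close> and to 0 modulo \<open>q\<close>, so this power map lands in the
      \<open>m\<close>-torsion and fixes it pointwise.\<close>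
    define f where "f = (\<lambda>x\<in>carrier G. x [^] (v * int q))"
    have "(\<lambda>x. x [^] (v * int q)) \<in> hom G G"
      by (rule homI) (auto simp: int_pow_distrib)
    then have f: "f \<in> carrier (endo_ring G)" unfolding f_def by (rule restrict_in_endo)
    have fS: "f ` carrier G \<subseteq> {x \<in> carrier G. x [^] m = \<one>}"
    proof safe
      fix x assume x: "x \<in> carrier G"
      then have "f x [^] m = (x [^] e) [^] v"
        by (simp add: f_def em int_pow_pow mult_ac flip: int_pow_int)
      then show "f x [^] m = \<one>" using e x by simp
    qed (use f in simp)
    \<comment> \<open>As \<open>q < e\<close>, some \<open>q\<close>-th power is nontrivial; being
      \<open>m\<close>-torsion, it is the fixed point needed for
      \<open>t_fine_fully_invariant\<close>.\<close>
    obtain y where y: "y \<in> carrier G" "y [^] q \<noteq> \<one>" using emin[of q] q1 m1 by auto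
    have xm: "(y [^] q) [^] m = \<one>" using e y em by (simp add: nat_pow_pow)
    have "f (y [^] q) = (y [^] q) [^] (1 - u * int m)"
      using y uv by (simp add: f_def algebra_simps flip: uv)
    also have "\<dots> = (y [^] q) [^] (1::int) \<otimes> inv (((y [^] q) [^] m) [^] u)"
      using y by (simp add: int_pow_diff int_pow_pow mult_ac flip: int_pow_int)
    finally have "f (y [^] q) = y [^] q" using y xm by simp
    then have "carrier G \<subseteq> {x \<in> carrier G. x [^] m = \<one>}"
      by (intro t_fine_fully_invariant[OF tf _ pow_kernel_subgroup _ endo_pow_kernel f fS])
        (use y in auto)
    then show False using emin[of m] m1 by blast
  qed
  then have eq: "e = p ^ Suc l" using m l by simp
  have "1 \<le> p ^ l" "p ^ l < e" using p1 eq by auto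
  then show ?thesis using that[OF p(1), of l] e(2) emin[of "p ^ l"] eq by blast
qed

text \<open>The retraction onto a cyclic factor of maximal order fixes its generator
  \<open>x\<close> and sends the socle of \<open>G\<close> into the socle of that factor, which
  consists of \<open>p ^ l\<close>-th powers. Full invariance extends this inclusion to the whole
  socle.\<close>

theorem t_fine_imp_homocyclic:
  assumes tf: "generalized_t_fine (endo_ring G)"
  shows "\<exists>(p::nat) (l::nat). homocyclic_group G p l"
proof -
  obtain p l :: nat where p: "Factorial_Ring.prime p"
    and exp: "\<And>x. x \<in> carrier G \<Longrightarrow> x [^] (p ^ Suc l) = \<one>"
    and "\<exists>x\<in>carrier G. x [^] (p ^ l) \<noteq> \<one>"
    using t_fine_exponent_prime_power[OF tf] by metis
  then obtain x where x: "x \<in> carrier G" "x [^] (p ^ l) \<noteq> \<one>" by blast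
  obtain f where f: "f \<in> carrier (endo_ring G)" "f x = x"
    "f ` carrier G \<subseteq> range (\<lambda>i::int. x [^] i)"
    using cyclic_retract[OF p exp x] by blast
  have fS: "f ` {t \<in> carrier G. t [^] p = \<one>} \<subseteq> (\<lambda>y. y [^] (p ^ l)) ` carrier G"
  proof clarify
    fix t assume t: "t \<in> carrier G" "t [^] p = \<one>"
    obtain i :: int where i: "f t = x [^] i" using f(3) t(1) by blast
    have "x [^] (i * int p) = (x [^] i) [^] p"
      using x(1) by (simp add: int_pow_pow flip: int_pow_int)
    also have "\<dots> = f (t [^] p)" using endo_nat_pow_hom[OF f(1) t(1)] i by simp
    finally have "x [^] (i * int p) = \<one>" using t f by simp
    then have "int (p ^ Suc l) dvd i * int p"
      using prime_power_dvd_exponent[OF p triv_subgroup x(1), of l "i * int p"] exp[OF x(1)] x by auto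
    then have "int (p ^ l) dvd i" using prime_gt_0_nat[OF p] by (simp add: mult.commute)
    then obtain j where "i = int (p ^ l) * j" by (elim dvdE)
    then have "f t = (x [^] j) [^] (p ^ l)"
      using i x(1) by (simp add: int_pow_pow mult.commute flip: int_pow_int)
    then show "f t \<in> (\<lambda>y. y [^] (p ^ l)) ` carrier G" using x(1) by blast
  qed
  have "x \<noteq> \<one>" using x(2) by auto
  then have "{t \<in> carrier G. t [^] p = \<one>} \<subseteq> (\<lambda>y. y [^] (p ^ l)) ` carrier G"
    by (intro t_fine_fully_invariant[OF tf _ pow_image_subgroup endo_pow_kernel endo_pow_image f(1) fS])
      (use x(1) f(2) in auto)
  then have "homocyclic_group G p l"
    using p exp t_fine_nontrivial[OF tf] by unfold_locales auto
  then show ?thesis by blast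
qed

end

section \<open>Direct powers of a cyclic group are homocyclic\<close>

lemma nat_pow_product_group:
  assumes "h \<in> carrier (product_group I G)"
  shows "h [^]\<^bsub>product_group I G\<^esub> (m::nat) = (\<lambda>i\<in>I. h i [^]\<^bsub>G i\<^esub> m)"
  by (induction m) (auto simp: restrict_def)

lemma (in finite_comm_group) iso_product_imp_homocyclic:
  fixes p l n :: nat
  assumes p: "Factorial_Ring.prime p" and n: "n \<ge> 1"
    and iso: "G \<cong> product_group {..<n} (\<lambda>_. integer_mod_group (p ^ Suc l))"
  shows "homocyclic_group G p l"
proof -
  let ?q = "p ^ Suc l"
  let ?H = "product_group {..<n} (\<lambda>_. integer_mod_group ?q)"
  interpret H: group ?H by simp
  obtain \<phi> where \<phi>: "\<phi> \<in> iso G ?H" using iso by (auto simp: is_iso_def)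
  have q0: "?q > 0" using prime_gt_0_nat[OF p] by simp
  have inj: "inj_on \<phi> (carrier G)" and surj: "\<phi> ` carrier G = carrier ?H" and hom: "\<phi> \<in> hom G ?H"
    using \<phi> by (simp_all only: iso_def bij_betw_def mem_Collect_eq)
  interpret \<phi>: group_hom G ?H \<phi>
    using hom by unfold_locales
  have pow: "\<phi> (x [^] (m::nat)) i = (int m * \<phi> x i) mod int ?q"
    if "x \<in> carrier G" "i < n" for x m i
    using that \<phi>.hom_nat_pow[OF that(1), of m] nat_pow_product_group[OF \<phi>.hom_closed[OF that(1)], of m]
    by simp
  have range: "0 \<le> \<phi> x i" "\<phi> x i < int ?q" if "x \<in> carrier G" "i < n" for x i
    using \<phi>.hom_closed[OF that(1)] that(2) q0 by (auto simp: carrier_integer_mod_group PiE_iff)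
  have eqI: "x = y" if "x \<in> carrier G" "y \<in> carrier G" "\<And>i. i < n \<Longrightarrow> \<phi> x i = \<phi> y i" for x y
  proof (rule inj_onD[OF inj _ that(1,2)])
    show "\<phi> x = \<phi> y"
      using \<phi>.hom_closed[OF that(1)] \<phi>.hom_closed[OF that(2)] that(3)
      unfolding carrier_product_group by (intro PiE_ext) auto
  qed
  have one: "\<phi> \<one> i = 0" if "i < n" for i
    using \<phi>.hom_one that by simp
  show ?thesis
  proof
    fix x assume x: "x \<in> carrier G"
    show "x [^] ?q = \<one>"
      by (rule eqI) (use x in \<open>simp_all only: pow one nat_pow_closed one_closed mod_mult_self1_is_0\<close>)
    assume xp: "x [^] p = \<one>"
    \<comment> \<open>Each coordinate of an element killed by \<open>p\<close> is a multiple of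
      \<open>p ^ l\<close>, so dividing coordinatewise yields a \<open>p ^ l\<close>-th root. The
      quotients stay in the residue range \<open>0 .. p ^ Suc l - 1\<close> required by the
      carrier.\<close>
    have dv: "int (p ^ l) dvd \<phi> x i" if "i < n" for i
    proof -
      have "(int p * \<phi> x i) mod int ?q = 0" using pow[OF x that, of p] xp one[OF that] by simp
      then have "int p * int (p ^ l) dvd int p * \<phi> x i" by (simp add: mod_eq_0_iff_dvd)
      then show ?thesis using prime_gt_0_nat[OF p] by simp
    qed
    let ?h = "\<lambda>i\<in>{..<n}. \<phi> x i div int (p ^ l)"
    have "0 \<le> \<phi> x i div int (p ^ l) \<and> \<phi> x i div int (p ^ l) < int ?q" if "i < n" for i
    proof
      show "0 \<le> \<phi> x i div int (p ^ l)" using range[OF x that] by (simp add: div_int_pos_iff)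
      have "\<phi> x i div int (p ^ l) \<le> \<phi> x i"
        using zdiv_mono2[OF range(1)[OF x that], of 1 "int (p ^ l)"] prime_gt_0_nat[OF p]
        by (simp add: Suc_le_eq flip: of_nat_power)
      then show "\<phi> x i div int (p ^ l) < int ?q" using range[OF x that] by linarith
    qed
    then have "?h \<in> carrier ?H" using q0 unfolding carrier_product_group
      by (intro restrict_PiE_iff[THEN iffD2]) (simp add: carrier_integer_mod_group del: power_Suc)
    then obtain y where y: "y \<in> carrier G" "\<phi> y = ?h" using surj by (metis imageE)
    have "y [^] (p ^ l) = x"
    proof (rule eqI)
      fix i assume i: "i < n"
      have "\<phi> (y [^] (p ^ l)) i = (int (p ^ l) * (\<phi> x i div int (p ^ l))) mod int ?q"
        unfolding pow[OF y(1) i] y(2) using i by simp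
      also have "\<dots> = \<phi> x i mod int ?q" using dv[OF i] by simp
      also have "\<dots> = \<phi> x i" using range[OF x i] by simp
      finally show "\<phi> (y [^] (p ^ l)) i = \<phi> x i" .
    qed (use x y in auto)
    then show "\<exists>y\<in>carrier G. y [^] (p ^ l) = x" using y by blast
  next
    show "carrier G \<noteq> {\<one>}"
    proof
      assume "carrier G = {\<one>}"
      then have "trivial_group G" by (simp add: trivial_group)
      then have "trivial_group ?H"
        using isomorphic_group_triviality[OF iso is_group H.is_group] by blast
      moreover have "0 \<in> {..<n}" using n by simp
      ultimately have "?q = 1" unfolding trivial_product_group trivial_integer_mod_group by blast
      then show False using prime_gt_1_nat[OF p] by simp
    qed
  qed (rule p)
qed

section \<open>Bases\<close>

context comm_group
begin

text \<open>A linear combination in multiplicative notation, with integer coefficients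
  \<open>a\<close>. The vectors are indexed through \<open>y\<close> so that the same coefficients
  can be applied to the images of a basis.\<close>

definition power_prod :: "('a \<Rightarrow> 'a) \<Rightarrow> 'a set \<Rightarrow> ('a \<Rightarrow> int) \<Rightarrow> 'a" where
  "power_prod y E a = (\<Otimes>x\<in>E. y x [^] a x)"

lemma power_prod_closed [simp]: "y \<in> E \<rightarrow> carrier G \<Longrightarrow> power_prod y E a \<in> carrier G"
  unfolding power_prod_def by (rule finprod_closed) auto

lemma power_prod_add:
  assumes "y \<in> E \<rightarrow> carrier G"
  shows "power_prod y E (\<lambda>x. a x + b x) = power_prod y E a \<otimes> power_prod y E b"
proof -
  have "power_prod y E (\<lambda>x. a x + b x) = (\<Otimes>x\<in>E. y x [^] a x \<otimes> y x [^] b x)"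
    unfolding power_prod_def using assms by (intro finprod_cong') (auto intro!: int_pow_mult)
  also have "\<dots> = power_prod y E a \<otimes> power_prod y E b"
    unfolding power_prod_def using assms by (intro finprod_multf) auto
  finally show ?thesis .
qed

lemma power_prod_insert:
  assumes "finite E" "z \<notin> E" "y \<in> insert z E \<rightarrow> carrier G"
  shows "power_prod y (insert z E) a = y z [^] a z \<otimes> power_prod y E a"
  unfolding power_prod_def using assms by (intro finprod_insert) auto

lemma power_prod_mult:
  assumes "finite E" "y \<in> E \<rightarrow> carrier G"
  shows "power_prod y E (\<lambda>x. a x * m) = power_prod y E a [^] (m::int)"
  using assms
proof (induction E rule: finite_induct)
  case empty
  then show ?case by (simp add: power_prod_def)
next
  case (insert z E)
  then have "y \<in> E \<rightarrow> carrier G" "y z \<in> carrier G" by auto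
  then show ?case using insert by (simp add: power_prod_insert int_pow_distrib int_pow_pow)
qed

lemma power_prod_single:
  assumes "finite E" "y \<in> E \<rightarrow> carrier G" "x \<in> E"
  shows "power_prod y E (\<lambda>z. if z = x then 1 else 0) = y x"
proof -
  have "power_prod y E (\<lambda>z. if z = x then 1 else 0) = (\<Otimes>z\<in>E. if x = z then y z else \<one>)"
    unfolding power_prod_def using assms by (intro finprod_cong') (auto simp: Pi_iff)
  also have "\<dots> = y x" by (rule finprod_singleton[OF assms(3,1,2)])
  finally show ?thesis .
qed

abbreviation span :: "'a set \<Rightarrow> 'a set" where
  "span E \<equiv> range (power_prod (\<lambda>x. x) E)"

lemma span_mem: "finite E \<Longrightarrow> E \<subseteq> carrier G \<Longrightarrow> x \<in> E \<Longrightarrow> x \<in> span E"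
  using power_prod_single[of E "\<lambda>x. x" x] by (metis Pi_I rangeI subsetD)

lemma span_subgroup:
  assumes "finite E" "E \<subseteq> carrier G"
  shows "subgroup (span E) G"
proof (rule subgroupI)
  have y: "(\<lambda>x. x) \<in> E \<rightarrow> carrier G" using assms by auto
  then show "span E \<subseteq> carrier G" by auto
  show "span E \<noteq> {}" by auto
  fix g assume "g \<in> span E"
  then obtain a where a: "g = power_prod (\<lambda>x. x) E a" by auto
  have "inv g = power_prod (\<lambda>x. x) E (\<lambda>x. a x * - 1)"
    unfolding power_prod_mult[OF assms(1) y] using y a by (simp add: int_pow_neg)
  then show "inv g \<in> span E" by blast
  fix h assume "h \<in> span E"
  then obtain b where b: "h = power_prod (\<lambda>x. x) E b" by auto
  show "g \<otimes> h \<in> span E" unfolding a b power_prod_add[OF y, symmetric] by blast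
qed

end

context homocyclic_group
begin

abbreviation q :: int where "q \<equiv> int (p ^ Suc l)"

lemma p_pos: "p > 0"
  using prime_gt_0_nat[OF prime] .

lemma pow_dvd_exponent:
  assumes "x \<in> carrier G" "q dvd c"
  shows "x [^] c = \<one>"
proof -
  obtain d where "c = q * d" using assms(2) by (elim dvdE)
  then have "x [^] c = (x [^] (p ^ Suc l)) [^] d"
    using assms(1) by (simp only: int_pow_pow flip: int_pow_int)
  then show ?thesis by (simp only: exponent[OF assms(1)] int_pow_one)
qed

lemma power_prod_cong:
  assumes "y \<in> E \<rightarrow> carrier G" "\<And>x. x \<in> E \<Longrightarrow> q dvd a x - b x"
  shows "power_prod y E a = power_prod y E b"
  unfolding power_prod_def
proof (rule finprod_cong')
  fix x assume x: "x \<in> E"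
  then have yx: "y x \<in> carrier G" using assms(1) by auto
  have "y x [^] a x = y x [^] (a x - b x) \<otimes> y x [^] b x"
    using yx by (simp flip: int_pow_mult)
  then show "y x [^] a x = y x [^] b x"
    using yx pow_dvd_exponent[OF yx assms(2)[OF x]] by simp
qed (use assms in auto)

text \<open>Linear independence over \<int>/q, expressed with integer representatives; in particular
  every member has order exactly \<open>q\<close>.\<close>

definition independent :: "'a set \<Rightarrow> bool" where
  "independent E \<longleftrightarrow> E \<subseteq> carrier G \<and>
     (\<forall>a. power_prod (\<lambda>x. x) E a = \<one> \<longrightarrow> (\<forall>x\<in>E. q dvd a x))"

definition basis :: "'a set \<Rightarrow> bool" where
  "basis E \<longleftrightarrow> independent E \<and> span E = carrier G"

lemma independent_finite: "independent E \<Longrightarrow> finite E"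
  using finite_carrier finite_subset unfolding independent_def by blast

lemma independent_id: "independent E \<Longrightarrow> (\<lambda>x. x) \<in> E \<rightarrow> carrier G"
  unfolding independent_def by auto

lemma independent_empty: "independent {}"
  by (simp add: independent_def)

text \<open>By the hypothesis on \<open>z [^] (p ^ l)\<close>, the order of \<open>z\<close> modulo
  the span is the full \<open>q\<close>. The coefficient of \<open>z\<close> in a relation is
  therefore divisible by \<open>q\<close>, and a relation within \<open>E\<close> remains.\<close>

lemma independent_insert:
  assumes E: "independent E" and z: "z \<in> carrier G" "z [^] (p ^ l) \<notin> span E"
  shows "independent (insert z E)"
  unfolding independent_def
proof (intro conjI allI impI)
  have fin: "finite E" and sub: "E \<subseteq> carrier G"
    using independent_finite[OF E] E by (auto simp: independent_def)
  have S: "subgroup (span E) G" by (rule span_subgroup[OF fin sub])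
  have "z \<notin> E"
    using z(2) span_mem[OF fin sub, of z] subgroup_int_pow_closed[OF S, of z "int (p ^ l)"]
    unfolding int_pow_int by blast
  show "insert z E \<subseteq> carrier G" using z sub by auto
  fix a assume a: "power_prod (\<lambda>x. x) (insert z E) a = \<one>"
  have pc: "power_prod (\<lambda>x. x) E a \<in> carrier G"
    by (rule power_prod_closed[OF independent_id[OF E]])
  have eq: "z [^] a z \<otimes> power_prod (\<lambda>x. x) E a = \<one>"
    using a z sub \<open>z \<notin> E\<close> fin by (subst (asm) power_prod_insert) auto
  then have "z [^] a z = inv (power_prod (\<lambda>x. x) E a)"
    using z pc by (metis int_pow_closed inv_equality m_comm inv_inv)
  then have "z [^] a z \<in> span E"
    using subgroup.m_inv_closed[OF S] by (metis rangeI)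
  moreover have "z [^] (p ^ Suc l) \<in> span E"
    unfolding exponent[OF z(1)] by (rule subgroup.one_closed[OF S])
  ultimately have dz: "q dvd a z"
    using prime_power_dvd_exponent[OF prime S z(1)] z(2) by blast
  then have "power_prod (\<lambda>x. x) E a = \<one>"
    using eq pc pow_dvd_exponent[OF z(1)] by simp
  then have "\<forall>x\<in>E. q dvd a x" using E unfolding independent_def by blast
  then show "\<forall>x\<in>insert z E. q dvd a x" using dz by blast
qed

text \<open>Maximality puts every \<open>p ^ l\<close>-th power into the span, and with it the
  socle. Higher orders follow by induction, dividing by roots that exist inside the span.\<close>

lemma maximal_independent_spans:
  assumes E: "independent E"
    and max: "\<And>z. z \<in> carrier G \<Longrightarrow> independent (insert z E) \<Longrightarrow> z \<in> E"
  shows "basis E"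
proof -
  have fin: "finite E" and sub: "E \<subseteq> carrier G"
    using independent_finite[OF E] E by (auto simp: independent_def)
  have S: "subgroup (span E) G" by (rule span_subgroup[OF fin sub])
  have id: "(\<lambda>x. x) \<in> E \<rightarrow> carrier G" by (rule independent_id[OF E])
  have powS: "z [^] (p ^ l) \<in> span E" if "z \<in> carrier G" for z
  proof (rule ccontr)
    assume no: "z [^] (p ^ l) \<notin> span E"
    then have "z \<in> E" using independent_insert[OF E that] max that by blast
    then show False
      using no span_mem[OF fin sub] subgroup_int_pow_closed[OF S, of z "int (p ^ l)"]
      unfolding int_pow_int by blast
  qed
  have "g \<in> span E" if "g \<in> carrier G" "g [^] (p ^ j) = \<one>" "j \<le> Suc l" for g j
    using that
  proof (induction j arbitrary: g)
    case 0
    then have "g = \<one>" by simp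
    then show ?case using subgroup.one_closed[OF S] by simp
  next
    case (Suc j)
    have "(g [^] (p ^ j)) [^] p = \<one>" using Suc.prems by (simp add: nat_pow_pow mult.commute)
    then obtain y where "y \<in> carrier G" "y [^] (p ^ l) = g [^] (p ^ j)"
      using socle_divisible[of "g [^] (p ^ j)"] Suc.prems by auto
    then have "g [^] (p ^ j) \<in> span E" using powS by metis
    then obtain a where a: "g [^] (p ^ j) = power_prod (\<lambda>x. x) E a" by auto
    \<comment> \<open>The combination is killed by \<open>p\<close>, so independence makes its
      coefficients divisible by \<open>p ^ l\<close>, hence by \<open>p ^ j\<close>. Dividing them
      by \<open>p ^ j\<close> gives \<open>h\<close> in the span with
      \<open>h [^] (p ^ j) = g [^] (p ^ j)\<close>, and the induction hypothesis applies to the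
      quotient of \<open>g\<close> by \<open>h\<close>.\<close>
    have "power_prod (\<lambda>x. x) E (\<lambda>x. a x * int p) = \<one>"
      unfolding power_prod_mult[OF fin id] a[symmetric] int_pow_int by fact
    then have "q dvd a x * int p" if "x \<in> E" for x
      using E that unfolding independent_def by blast
    then have dv: "int (p ^ l) dvd a x" if "x \<in> E" for x
      using that p_pos by (simp add: mult.commute)
    define h where "h = power_prod (\<lambda>x. x) E (\<lambda>x. a x div int (p ^ j))"
    have h: "h \<in> carrier G" "h \<in> span E" using id by (auto simp: h_def)
    have "j \<le> l" using Suc.prems by simp
    then have "int (p ^ j) dvd int (p ^ l)" by (simp add: le_imp_power_dvd)
    then have "int (p ^ j) dvd a x" if "x \<in> E" for x using dv[OF that] dvd_trans by blast
    then have "h [^] (p ^ j) = power_prod (\<lambda>x. x) E a"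
      unfolding h_def int_pow_int[symmetric] power_prod_mult[OF fin id, symmetric]
      by (intro power_prod_cong[OF id]) (simp add: dvd_div_mult_self del: of_nat_power)
    then have "(g \<otimes> inv h) [^] (p ^ j) = \<one>"
      using a h(1) Suc.prems(1) power_prod_closed[OF id] by (simp add: nat_pow_distrib nat_pow_inv)
    then have "g \<otimes> inv h \<in> span E" using Suc.IH[of "g \<otimes> inv h"] h Suc.prems by simp
    then have "g \<otimes> inv h \<otimes> h \<in> span E" using subgroup.m_closed[OF S] h(2) by blast
    then show ?case using Suc.prems(1) h(1) by (simp add: m_assoc)
  qed
  then have "carrier G \<subseteq> span E" using exponent by blast
  then show ?thesis using E subgroup.subset[OF S] unfolding basis_def by blast
qed

lemma independent_extend_basis:
  assumes "independent E"
  shows "\<exists>B. E \<subseteq> B \<and> basis B"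
proof -
  have "{B. independent B} \<subseteq> Pow (carrier G)" by (auto simp: independent_def)
  then have "finite {B. independent B}" using finite_carrier finite_subset by auto
  then obtain B where "independent B" "E \<subseteq> B" "\<And>C. independent C \<Longrightarrow> B \<subseteq> C \<Longrightarrow> B = C"
    using finite_has_maximal2[of "{B. independent B}" E] assms by auto
  then have "basis B" by (intro maximal_independent_spans) blast+
  then show ?thesis using \<open>E \<subseteq> B\<close> by blast
qed

lemma basis_extend_endo:
  assumes B: "basis B" and y: "y \<in> B \<rightarrow> carrier G"
  shows "\<exists>f\<in>carrier (endo_ring G). \<forall>x\<in>B. f x = y x"
proof -
  have ind: "independent B" and span: "span B = carrier G" using B by (auto simp: basis_def)
  have fin: "finite B" by (rule independent_finite[OF ind])
  have id: "(\<lambda>x. x) \<in> B \<rightarrow> carrier G" by (rule independent_id[OF ind])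
  \<comment> \<open>Coordinates are determined only modulo \<open>q\<close>. The choice does not
    affect \<open>f\<close>, because every \<open>y x\<close> is killed by \<open>q\<close>.\<close>
  define c where "c g = (SOME a. power_prod (\<lambda>x. x) B a = g)" for g
  have c: "power_prod (\<lambda>x. x) B (c g) = g" if "g \<in> carrier G" for g
  proof -
    have "g \<in> span B" using that span by simp
    then obtain a where "power_prod (\<lambda>x. x) B a = g" by (elim rangeE) simp
    then show ?thesis unfolding c_def by (rule someI[where P = "\<lambda>a. power_prod (\<lambda>x. x) B a = g"])
  qed
  define f where "f = (\<lambda>g\<in>carrier G. power_prod y B (c g))"
  have f: "f (power_prod (\<lambda>x. x) B a) = power_prod y B a" for a
  proof -
    let ?g = "power_prod (\<lambda>x. x) B a"
    have g: "?g \<in> carrier G" by (rule power_prod_closed[OF id])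
    have "power_prod (\<lambda>x. x) B (\<lambda>x. c ?g x + a x * - 1) = \<one>"
      unfolding power_prod_add[OF id] power_prod_mult[OF fin id] c[OF g]
      using g by (simp add: int_pow_neg)
    then have "\<forall>x\<in>B. q dvd c ?g x + a x * - 1" using ind unfolding independent_def by blast
    then have "power_prod y B (c ?g) = power_prod y B a"
      by (intro power_prod_cong[OF y]) (simp del: power_Suc of_nat_power)
    then show ?thesis using g by (simp add: f_def)
  qed
  have "f \<in> hom G G"
  proof (rule homI)
    fix g h assume g: "g \<in> carrier G" and h: "h \<in> carrier G"
    show "f g \<in> carrier G" using y g by (simp add: f_def)
    have "f (g \<otimes> h) = f (power_prod (\<lambda>x. x) B (\<lambda>x. c g x + c h x))"
      by (simp add: power_prod_add[OF id] c g h)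
    also have "\<dots> = f g \<otimes> f h" using g h unfolding f by (simp add: power_prod_add[OF y] f_def)
    finally show "f (g \<otimes> h) = f g \<otimes> f h" .
  qed
  moreover have "f \<in> extensional (carrier G)" unfolding f_def by (rule restrict_extensional)
  ultimately have "f \<in> carrier (endo_ring G)" unfolding endo_iff ..
  moreover have "f x = y x" if "x \<in> B" for x
    using f[of "\<lambda>z. if z = x then 1 else 0"]
    unfolding power_prod_single[OF fin id that] power_prod_single[OF fin y that] .
  ultimately show ?thesis by blast
qed

theorem iso_product:
  "\<exists>n::nat. n \<ge> 1 \<and> G \<cong> product_group {..<n} (\<lambda>_. integer_mod_group (p ^ Suc l))"
proof -
  obtain B where B: "basis B" using independent_extend_basis[OF independent_empty] by blast
  have ind: "independent B" and span: "span B = carrier G" using B by (auto simp: basis_def)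
  have fin: "finite B" by (rule independent_finite[OF ind])
  have id: "(\<lambda>x. x) \<in> B \<rightarrow> carrier G" by (rule independent_id[OF ind])
  define n where "n = card B"
  have "B \<noteq> {}" using span nontrivial by (auto simp: power_prod_def)
  then have n: "n \<ge> 1" using fin by (simp add: n_def Suc_le_eq card_gt_0_iff)
  obtain e where e: "bij_betw e B {..<n}"
    using ex_bij_betw_finite_nat[OF fin] by (auto simp: n_def atLeast0LessThan)
  have en: "e x < n" if "x \<in> B" for x using e that bij_betwE by blast
  let ?H = "product_group {..<n} (\<lambda>_. integer_mod_group (p ^ Suc l))"
  interpret H: group ?H by simp
  have q0: "q > 0" "p ^ Suc l \<noteq> 0" using p_pos by auto
  have carrier_H: "carrier ?H = ({..<n} \<rightarrow>\<^sub>E {0..<q})"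
    unfolding carrier_product_group carrier_integer_mod_group using q0(2) by simp
  \<comment> \<open>The isomorphism is built from coordinates to the group. Reduction modulo
    \<open>q\<close> in the product is harmless by \<open>power_prod_cong\<close>, and a trivial
    value forces coordinates divisible by \<open>q\<close> in \<open>{0..<q}\<close>, hence
    zero.\<close>
  define f where "f h = power_prod (\<lambda>x. x) B (\<lambda>x. h (e x))" for h
  have "f \<in> hom ?H G"
  proof (rule homI)
    fix h k assume "h \<in> carrier ?H" "k \<in> carrier ?H"
    show "f h \<in> carrier G" unfolding f_def by (rule power_prod_closed[OF id])
    have "f (h \<otimes>\<^bsub>?H\<^esub> k) = power_prod (\<lambda>x. x) B (\<lambda>x. h (e x) + k (e x))"
      unfolding f_def
    proof (rule power_prod_cong[OF id])
      fix x assume "x \<in> B"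
      then have "(h \<otimes>\<^bsub>?H\<^esub> k) (e x) = (h (e x) + k (e x)) mod q" using en by simp
      then show "q dvd (h \<otimes>\<^bsub>?H\<^esub> k) (e x) - (h (e x) + k (e x))"
        by (metis mod_eq_dvd_iff mod_mod_trivial)
    qed
    then show "f (h \<otimes>\<^bsub>?H\<^esub> k) = f h \<otimes> f k" unfolding f_def power_prod_add[OF id] .
  qed
  then interpret f: group_hom ?H G f by unfold_locales
  have "inj_on f (carrier ?H)"
    unfolding f.inj_on_one_iff
  proof (intro allI impI)
    fix h assume h: "h \<in> carrier ?H" "f h = \<one>"
    have "h i = 0" if i: "i < n" for i
    proof -
      obtain x where x: "x \<in> B" "e x = i" using e i unfolding bij_betw_def by (metis imageE lessThan_iff)
      then have "q dvd h i" using h(2) ind unfolding independent_def f_def by blast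
      moreover have "h i \<in> {0..<q}" using PiE_mem[OF h(1)[unfolded carrier_H]] i by blast
      then have "0 \<le> h i" "h i < q" unfolding atLeastLessThan_iff by blast+
      ultimately show ?thesis using zdvd_imp_le[of q "h i"] by linarith
    qed
    then show "h = \<one>\<^bsub>?H\<^esub>"
      by (intro PiE_ext[OF h(1)[unfolded carrier_H] H.one_closed[unfolded carrier_H]]) simp
  qed
  moreover have "carrier G \<subseteq> f ` carrier ?H"
  proof
    fix g assume "g \<in> carrier G"
    then have "g \<in> span B" using span by simp
    then obtain a where a: "g = power_prod (\<lambda>x. x) B a" by (rule rangeE)
    define h where "h = (\<lambda>i\<in>{..<n}. a (inv_into B e i) mod q)"
    have "h \<in> carrier ?H" unfolding carrier_H h_def using q0 by auto
    moreover have "f h = g" unfolding f_def a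
    proof (rule power_prod_cong[OF id])
      fix x assume x: "x \<in> B"
      then have "h (e x) = a x mod q"
        using en[OF x] bij_betw_inv_into_left[OF e x] by (simp add: h_def del: power_Suc)
      then show "q dvd h (e x) - a x" by (metis mod_eq_dvd_iff mod_mod_trivial)
    qed
    ultimately show "g \<in> f ` carrier ?H" by blast
  qed
  ultimately have "f \<in> iso ?H G"
    using f.homh f.hom_closed by (auto simp: iso_def bij_betw_def)
  then have "?H \<cong> G" by (auto simp: is_iso_def)
  then have "G \<cong> ?H" by (rule H.iso_sym)
  with n show ?thesis by blast
qed

end

section \<open>Decomposition of endomorphisms\<close>

context comm_group
begin

lemma mult_inv_cancel:
  assumes [simp]: "x \<in> carrier G" "y \<in> carrier G" "z \<in> carrier G"
  shows "x \<otimes> y \<otimes> inv (z \<otimes> y) = x \<otimes> inv z"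
proof -
  have "x \<otimes> y \<otimes> (inv y \<otimes> inv z) = x \<otimes> (y \<otimes> inv y) \<otimes> inv z"
    by (simp only: m_assoc m_closed inv_closed assms)
  then show ?thesis by (simp add: inv_mult_group)
qed

lemma span_minimal:
  assumes "finite E" "E \<subseteq> K" and K: "subgroup K G"
  shows "span E \<subseteq> K"
proof -
  have "power_prod (\<lambda>x. x) E a \<in> K" for a
    using assms(1,2)
  proof (induction E rule: finite_induct)
    case empty
    then show ?case using subgroup.one_closed[OF K] by (simp add: power_prod_def)
  next
    case (insert z E)
    then have "(\<lambda>x. x) \<in> insert z E \<rightarrow> carrier G" using subgroup.subset[OF K] by auto
    moreover have "z [^] a z \<in> K" using subgroup_int_pow_closed[OF K] insert by blast
    ultimately show ?case
      using insert subgroup.m_closed[OF K] by (simp add: power_prod_insert)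
  qed
  then show ?thesis by blast
qed

lemma span_mono:
  assumes "finite F" "F \<subseteq> carrier G" "E \<subseteq> F"
  shows "span E \<subseteq> span F"
  by (rule span_minimal) (use assms span_mem[OF assms(1,2)] span_subgroup finite_subset in blast)+

lemma span_empty: "span {} = {\<one>}"
  by (auto simp: power_prod_def)

lemma span_union_split:
  assumes "finite E" "finite F" "E \<inter> F = {}" "E \<union> F \<subseteq> carrier G" "g \<in> span (E \<union> F)"
  shows "\<exists>s\<in>span E. \<exists>t\<in>span F. g = s \<otimes> t"
proof -
  obtain a where a: "g = power_prod (\<lambda>x. x) (E \<union> F) a" using assms(5) by (rule rangeE)
  have "g = power_prod (\<lambda>x. x) E a \<otimes> power_prod (\<lambda>x. x) F a"
    unfolding a power_prod_def using assms(1-4) by (intro finprod_Un_disjoint) auto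
  then show ?thesis by blast
qed

text \<open>The preimage of \<open>K\<close> under \<open>f\<close> is a subgroup, so it contains
  the span once it contains the generators.\<close>

lemma endo_span_subset:
  assumes f: "f \<in> carrier (endo_ring G)" and E: "finite E" "E \<subseteq> carrier G"
    and K: "subgroup K G" "f ` E \<subseteq> K"
  shows "f ` span E \<subseteq> K"
proof -
  have "subgroup {x \<in> carrier G. f x \<in> K} G"
    using f subgroup.one_closed[OF K(1)] subgroup.m_closed[OF K(1)] subgroup.m_inv_closed[OF K(1)]
    by (intro subgroupI) (auto simp: endo_mult_hom endo_inv_hom)
  then have "span E \<subseteq> {x \<in> carrier G. f x \<in> K}"
    using E K(2) by (intro span_minimal) auto
  then show ?thesis by auto
qed

end

context homocyclic_group
begin

text \<open>In an ordered basis \<open>v, \<dots>, w\<close> with \<open>A v = w\<close>, the entries of \<open>A\<close> strictly above the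
  diagonal are replaced by ones on the first superdiagonal. The result is onto, because its image
  contains \<open>w\<close> and then, going backwards, every basis element; the difference to \<open>A\<close> is strictly
  upper triangular.\<close>

lemma unit_plus_nilpotent_if_basis:
  assumes A: "A \<in> carrier (endo_ring G)"
    and B: "basis B" and vw: "v \<in> B" "w \<in> B" "v \<noteq> w" "A v = w"
  shows "\<exists>u\<in>Units (endo_ring G). \<exists>n\<in>nilpotents (endo_ring G). A = u \<oplus>\<^bsub>endo_ring G\<^esub> n"
proof -
  interpret R: ring "endo_ring G" by (rule ring_endo)
  have ind: "independent B" and spanB: "span B = carrier G" using B by (auto simp: basis_def)
  have fin: "finite B" by (rule independent_finite[OF ind])
  have BG: "B \<subseteq> carrier G" using ind by (simp add: independent_def)
  obtain xs where xs: "set xs = B - {v, w}" "distinct xs"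
    using finite_distinct_list[of "B - {v, w}"] fin by auto
  define L where "L = v # xs @ [w]"
  define N where "N = length L"
  have L: "distinct L" "set L = B" using xs vw by (auto simp: L_def)
  have N2: "N \<ge> 2" by (simp add: N_def L_def)
  have L0: "L ! 0 = v" and LN: "L ! (N - 1) = w" by (simp_all add: L_def N_def nth_append)
  have LB: "L ! i \<in> B" if "i < N" for i using that L N_def nth_mem by blast
  have LG: "L ! i \<in> carrier G" if "i < N" for i using LB[OF that] BG by blast
  \<comment> \<open>\<open>S j\<close> is spanned by the basis elements before position
    \<open>j\<close>, \<open>T j\<close> by those from \<open>j\<close> on. Splitting
    \<open>A (L ! j)\<close> along them separates the entries of column \<open>j\<close> strictly
    above the diagonal, \<open>s j\<close>, from the remaining ones, \<open>t j\<close>.\<close>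
  define S where "S j = span (set (take j L))" for j
  define T where "T j = span (set (drop j L))" for j
  have subs: "set (take j L) \<subseteq> carrier G" "set (drop j L) \<subseteq> carrier G" for j
    using L BG set_take_subset[of j L] set_drop_subset[of j L] by blast+
  have S: "subgroup (S j) G" for j unfolding S_def by (rule span_subgroup) (simp_all add: subs)
  have S_mono: "S i \<subseteq> S j" if "i \<le> j" for i j
    unfolding S_def by (rule span_mono) (simp_all add: subs set_take_subset_set_take that)
  have LS: "L ! i \<in> S j" if "i < j" "i < N" for i j
    unfolding S_def
    by (rule span_mem) (use that subs in \<open>auto simp: in_set_conv_nth N_def intro!: exI[of _ i]\<close>)
  have "\<exists>s t. s \<in> S j \<and> t \<in> T j \<and> A (L ! j) = s \<otimes> t" if "j < N" for j
  proof -
    have "set (take j L) \<union> set (drop j L) = B"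
      using L(2) by (metis append_take_drop_id set_append)
    then show ?thesis
      using span_union_split[of "set (take j L)" "set (drop j L)" "A (L ! j)"]
        set_take_disj_set_drop_if_distinct[OF L(1), of j j] BG A LG[OF that] spanB
      unfolding S_def T_def by auto
  qed
  then obtain s t where st: "s j \<in> S j" "t j \<in> T j" "A (L ! j) = s j \<otimes> t j" if "j < N" for j
    by metis
  have sG: "s j \<in> carrier G" if "j < N" for j using st(1)[OF that] subgroup.subset[OF S] by blast
  have tG: "t j \<in> carrier G" if "j < N" for j
  proof -
    have "subgroup (T j) G" unfolding T_def by (rule span_subgroup) (simp_all add: subs)
    then show ?thesis using st(2)[OF that] subgroup.subset by blast
  qed
  define idx where "idx = inv_into {..<N} ((!) L)"
  have idx: "idx (L ! i) = i" if "i < N" for i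
    unfolding idx_def using L(1) that by (intro inv_into_f_f) (auto simp: inj_on_nth N_def)
  \<comment> \<open>The columns of \<open>u\<close>: \<open>t j\<close> is kept and
    \<open>s j\<close> is replaced by the preceding basis element. Column 0 has nothing above the
    diagonal, so it is copied from \<open>A\<close>; truncated subtraction would give
    \<open>L ! 0\<close> there.\<close>
  define y where "y x = (if x = v then w else L ! (idx x - 1) \<otimes> t (idx x))" for x
  have y_nth: "y (L ! j) = L ! (j - 1) \<otimes> t j" if "0 < j" "j < N" for j
  proof -
    have "j < length L" "0 < length L" using that unfolding N_def by linarith+
    then have "L ! j \<noteq> L ! 0" using nth_eq_iff_index_eq[OF L(1), of j 0] that(1) by blast
    then show ?thesis using idx[OF that(2)] L0 by (simp add: y_def)
  qed
  have "y x \<in> carrier G" if "x \<in> B" for x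
  proof -
    have "x \<in> set L" using that L(2) by simp
    then obtain j where j: "j < N" "x = L ! j" unfolding in_set_conv_nth N_def by blast
    show ?thesis
    proof (cases "j = 0")
      case True
      then show ?thesis using j L0 vw BG by (auto simp: y_def)
    next
      case False
      then show ?thesis using j y_nth LG tG by simp
    qed
  qed
  then obtain u where u: "u \<in> carrier (endo_ring G)" and uy: "\<And>x. x \<in> B \<Longrightarrow> u x = y x"
    using basis_extend_endo[OF B, of y] by blast
  have u0: "u v = w" using uy[OF vw(1)] by (simp add: y_def)
  have uL: "u (L ! j) = L ! (j - 1) \<otimes> t j" if "0 < j" "j < N" for j
    using uy[OF LB[OF that(2)]] y_nth[OF that] by simp

  have "u \<in> Units (endo_ring G)"
  proof (rule surj_endo_in_Units[OF u])
    have K: "subgroup (u ` carrier G) G"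
      by (rule group_hom.img_is_subgroup[OF endo_group_hom[OF u]])
    \<comment> \<open>Here \<open>m\<close> counts backwards from the last position. The start is
      \<open>w = u v\<close>; once all of \<open>T j\<close> lies in the image, so does
      \<open>L ! (j - 1)\<close>, the quotient of \<open>u (L ! j)\<close> by
      \<open>t j\<close>.\<close>
    have "\<forall>i. N - 1 - m \<le> i \<and> i < N \<longrightarrow> L ! i \<in> u ` carrier G" if "m < N" for m
      using that
    proof (induction m)
      case 0
      have "w \<in> u ` carrier G" using u0 vw(1) BG by blast
      moreover have "i = N - 1" if "N - 1 \<le> i" "i < N" for i using that by linarith
      ultimately show ?case using LN by auto
    next
      case (Suc m)
      define j where "j = N - 1 - m"
      have j: "0 < j" "j < N" "N - 1 - Suc m = j - 1" using Suc.prems by (auto simp: j_def)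
      have IH: "L ! i \<in> u ` carrier G" if "j \<le> i" "i < N" for i
        using Suc that by (simp add: j_def)
      have "set (drop j L) \<subseteq> u ` carrier G"
        using IH by (auto simp: in_set_conv_nth N_def)
      then have "T j \<subseteq> u ` carrier G" unfolding T_def by (intro span_minimal K) auto
      then have t: "t j \<in> u ` carrier G" using st(2)[OF j(2)] by blast
      have "L ! (j - 1) = u (L ! j) \<otimes> inv (t j)"
        using uL[OF j(1,2)] LG[of "j - 1"] tG[OF j(2)] j by (simp add: m_assoc)
      also have "\<dots> \<in> u ` carrier G"
        by (rule subgroup.m_closed[OF K imageI[OF LG[OF j(2)]] subgroup.m_inv_closed[OF K t]])
      finally have "L ! (j - 1) \<in> u ` carrier G" .
      moreover have "i = j - 1 \<or> j \<le> i" if "j - 1 \<le> i" for i using that by linarith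
      ultimately show ?case using IH unfolding j(3) by blast
    qed
    from this[of "N - 1"] have "set L \<subseteq> u ` carrier G"
      using N2 by (auto simp: in_set_conv_nth N_def)
    then have "span B \<subseteq> u ` carrier G" unfolding L(2) by (intro span_minimal fin K)
    then show "carrier G \<subseteq> u ` carrier G" unfolding spanB .
  qed

  moreover have "A \<ominus>\<^bsub>endo_ring G\<^esub> u \<in> nilpotents (endo_ring G)"
  proof -
    define n where "n = A \<ominus>\<^bsub>endo_ring G\<^esub> u"
    have n: "n \<in> carrier (endo_ring G)" using A u by (simp add: n_def)
    \<comment> \<open>In the difference the parts \<open>t j\<close> cancel, leaving only entries
      before position \<open>j\<close>. Thus \<open>n\<close> lowers the flag of the
      \<open>S j\<close> by one step each time, and \<open>N\<close> steps reach the trivial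
      subgroup.\<close>
    have nL: "n (L ! j) \<in> S j" if j: "j < N" for j
    proof (cases "j = 0")
      case True
      then have "n (L ! j) = \<one>"
        using u0 vw L0 A u BG LG[OF j] by (auto simp: n_def endo_minus_apply)
      then show ?thesis using subgroup.one_closed[OF S] by simp
    next
      case False
      have "n (L ! j) = s j \<otimes> t j \<otimes> inv (L ! (j - 1) \<otimes> t j)"
        using False j uL[of j] st(3)[OF j] A u LG[OF j] by (simp add: n_def endo_minus_apply)
      also have "\<dots> = s j \<otimes> inv (L ! (j - 1))"
        by (rule mult_inv_cancel) (use sG tG LG j in auto)
      also have "\<dots> \<in> S j"
        using subgroup.m_closed[OF S st(1)[OF j] subgroup.m_inv_closed[OF S LS]] False j by simp
      finally show ?thesis .
    qed
    have nS: "n ` S (Suc j) \<subseteq> S j" for j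
      unfolding S_def[of "Suc j"]
    proof (rule endo_span_subset[OF n _ _ S])
      show "n ` set (take (Suc j) L) \<subseteq> S j"
      proof clarify
        fix x assume "x \<in> set (take (Suc j) L)"
        then obtain i where i: "i < N" "i \<le> j" "x = L ! i"
          by (auto simp: in_set_conv_nth N_def)
        then show "n x \<in> S j" using nL[of i] S_mono[of i j] by blast
      qed
    qed (use subs in auto)
    have "(n ^^ j) x = \<one>" if "x \<in> S j" for j x
      using that
    proof (induction j arbitrary: x)
      case 0
      then show ?case by (simp add: S_def span_empty)
    next
      case (Suc j)
      then have "n x \<in> S j" using nS by blast
      then show ?case using Suc.IH by (simp add: funpow_swap1)
    qed
    moreover have "S N = carrier G" using L(2) spanB by (simp add: S_def N_def)
    ultimately show ?thesis using n unfolding n_def[symmetric]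
      by (intro endo_in_nilpotentsI[of n N]) auto
  qed
  moreover have "A = u \<oplus>\<^bsub>endo_ring G\<^esub> (A \<ominus>\<^bsub>endo_ring G\<^esub> u)"
    using A u by (simp add: R.minus_eq R.a_lcomm[of u A] R.r_neg)
  ultimately show ?thesis by blast
qed

section \<open>Endomorphisms and the lines of the socle\<close>

lemma power_in_socle:
  assumes x: "x \<in> carrier G" "x \<noteq> \<one>"
  obtains i :: nat where "x [^] i \<noteq> \<one>" "(x [^] i) [^] p = \<one>"
proof -
  \<comment> \<open>The wanted power is the last nontrivial term among the iterated
    \<open>p\<close>-th powers of \<open>x\<close>.\<close>
  define m where "m = (LEAST m. x [^] (p ^ m) = \<one>)"
  have m: "x [^] (p ^ m) = \<one>"
    unfolding m_def by (rule LeastI[where P = "\<lambda>m. x [^] (p ^ m) = \<one>", OF exponent[OF x(1)]])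
  have "m \<noteq> 0" using m x by (metis nat_pow_eone power_0)
  then obtain m' where m': "m = Suc m'" using not0_implies_Suc by blast
  have "x [^] (p ^ m') \<noteq> \<one>"
    using not_less_Least[of m' "\<lambda>m. x [^] (p ^ m) = \<one>"] m' m_def by auto
  moreover have "(x [^] (p ^ m')) [^] p = \<one>"
    using m x by (simp add: nat_pow_pow m' mult.commute)
  ultimately show ?thesis using that by blast
qed

lemma socle_dvd_exponent:
  assumes K: "subgroup K G" and s: "s \<in> carrier G" "s [^] p = \<one>" "s \<notin> K" "s [^] (j::int) \<in> K"
  shows "int p dvd j"
  using prime_power_dvd_exponent[OF prime K s(1), of 0 j] s subgroup.one_closed[OF K] by simp

lemma socle_pow_eq_one:
  assumes "s \<in> carrier G" "s [^] p = \<one>" "int p dvd j"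
  shows "s [^] j = \<one>"
proof -
  obtain i where "j = int p * i" using assms(3) by (elim dvdE)
  then have "s [^] j = (s [^] p) [^] i" using assms(1) by (simp add: int_pow_pow flip: int_pow_int)
  then show ?thesis using assms(2) by simp
qed

text \<open>A \<open>p ^ l\<close>-th root \<open>v\<close> of \<open>s\<close> and its image
  \<open>A v\<close> are independent, since their \<open>p ^ l\<close>-th powers \<open>s\<close>
  and \<open>A s\<close> lie on different lines. A basis containing both has the shape required by
  \<open>unit_plus_nilpotent_if_basis\<close>.\<close>

lemma unit_plus_nilpotent_if_moves_socle_line:
  assumes A: "A \<in> carrier (endo_ring G)"
    and s: "s \<in> carrier G" "s [^] p = \<one>" "A s \<notin> range (\<lambda>i::int. s [^] i)"
  shows "\<exists>u\<in>Units (endo_ring G). \<exists>n\<in>nilpotents (endo_ring G). A = u \<oplus>\<^bsub>endo_ring G\<^esub> n"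
proof -
  obtain v where v: "v \<in> carrier G" "v [^] (p ^ l) = s" using socle_divisible s by blast
  have "s \<noteq> \<one>"
  proof
    assume "s = \<one>"
    then have "A s = s [^] (0::int)" using A by simp
    then show False using s(3) by blast
  qed
  then have iv: "independent {v}"
    using independent_insert[OF independent_empty v(1)] v(2) by (simp add: span_empty)
  have wl: "A v [^] (p ^ l) \<notin> span {v}"
  proof
    assume "A v [^] (p ^ l) \<in> span {v}"
    then have "A s \<in> span {v}" using v A by (simp flip: endo_nat_pow_hom)
    then obtain a where "A s = power_prod (\<lambda>x. x) {v} a" by (rule rangeE)
    then have a: "A s = v [^] a v" using v(1) by (simp add: power_prod_insert power_prod_def)
    \<comment> \<open>As \<open>A s\<close> is killed by \<open>p\<close> while \<open>v\<close> has
      order \<open>q\<close>, the exponent \<open>a v\<close> is a multiple of \<open>p ^ l\<close>,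
      so \<open>A s\<close> would already be a power of \<open>s\<close>.\<close>
    have "v [^] (a v * int p) = (A s) [^] p"
      unfolding a using v(1) by (simp add: int_pow_pow flip: int_pow_int)
    also have "\<dots> = A (s [^] p)" using endo_nat_pow_hom[OF A s(1)] by simp
    finally have 1: "v [^] (a v * int p) = \<one>" using s A by simp
    have "q dvd a v * int p"
      using prime_power_dvd_exponent[OF prime triv_subgroup v(1), of l "a v * int p"]
        1 exponent[OF v(1)] v(2) \<open>s \<noteq> \<one>\<close> by auto
    then have "int (p ^ l) dvd a v" using p_pos by (simp add: mult.commute)
    then obtain i where "a v = int (p ^ l) * i" by (elim dvdE)
    then have "A s = (v [^] int (p ^ l)) [^] i"
      unfolding a using v(1) by (simp add: int_pow_pow)
    also have "\<dots> = s [^] i" by (simp only: int_pow_int v(2))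
    finally have "A s = s [^] i" .
    then show False using s(3) by blast
  qed
  have "A v \<noteq> v"
  proof
    assume "A v = v"
    then have "A v [^] (p ^ l) = v [^] int (p ^ l)" by (simp only: int_pow_int)
    also have "\<dots> \<in> span {v}"
      using v(1) span_mem[of "{v}" v] by (intro subgroup_int_pow_closed span_subgroup) auto
    finally show False using wl by simp
  qed
  moreover have "independent {A v, v}"
    using independent_insert[OF iv _ wl] v(1) A by simp
  then obtain B where "{A v, v} \<subseteq> B" "basis B" using independent_extend_basis by blast
  ultimately show ?thesis using unit_plus_nilpotent_if_basis[OF A, of B v "A v"] by auto
qed

text \<open>A linear map over the field with \<open>p\<close> elements that preserves every line is
  a scalar. The scalar by which \<open>A\<close> acts on the socle is nonzero because of
  \<open>r\<close>, so the kernel of \<open>A\<close> misses the socle and is trivial.\<close>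

lemma unit_if_fixes_socle_lines:
  assumes A: "A \<in> carrier (endo_ring G)"
    and lines: "\<And>s. s \<in> carrier G \<Longrightarrow> s [^] p = \<one> \<Longrightarrow> A s \<in> range (\<lambda>i::int. s [^] i)"
    and r: "r \<in> carrier G" "r [^] p = \<one>" "A r \<noteq> \<one>"
  shows "A \<in> Units (endo_ring G)"
proof (rule inj_endo_in_Units[OF A], rule ccontr)
  fix x assume x: "x \<in> carrier G" "A x = \<one>" "x \<noteq> \<one>"
  obtain k :: nat where k: "x [^] k \<noteq> \<one>" "(x [^] k) [^] p = \<one>"
    using power_in_socle[OF x(1,3)] by blast
  define s where "s = x [^] k"
  have s: "s \<in> carrier G" "s \<noteq> \<one>" "s [^] p = \<one>" "A s = \<one>"
    using k x A by (simp_all add: s_def endo_nat_pow_hom)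
  obtain i :: int where i: "A r = r [^] i" using lines[OF r(1,2)] by blast
  \<comment> \<open>The line through \<open>r \<otimes> s\<close> links the scalars of
    \<open>r\<close> and \<open>s\<close>. If \<open>s\<close> is off the line of \<open>r\<close>,
    then \<open>p\<close> divides the common exponent \<open>j\<close> and \<open>A r\<close> is
    trivial; if \<open>s\<close> is a power of \<open>r\<close>, then \<open>A s = \<one>\<close>
    forces \<open>p\<close> to divide \<open>i\<close>. Both contradict the choice of
    \<open>r\<close>.\<close>
  have "(r \<otimes> s) [^] p = \<one>" using r s by (simp add: nat_pow_distrib)
  then obtain j :: int where "A (r \<otimes> s) = (r \<otimes> s) [^] j" using lines[of "r \<otimes> s"] r(1) s(1) by blast
  then have j: "r [^] i = r [^] j \<otimes> s [^] j"
    using r(1) s i A by (simp add: endo_mult_hom int_pow_distrib)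
  have C: "subgroup (range (\<lambda>i::int. r [^] i)) G" using r(1) by (rule subgroup_of_powers)
  have "r [^] i = s [^] j \<otimes> r [^] j" using j r(1) s(1) by (simp add: m_comm)
  then have "s [^] j = r [^] i \<otimes> inv (r [^] j)" using r(1) s(1) by (simp add: m_assoc)
  also have "\<dots> = r [^] (i - j)" using r(1) by (simp add: int_pow_diff)
  finally have sj: "s [^] j = r [^] (i - j)" .
  show False
  proof (cases "s \<in> range (\<lambda>i::int. r [^] i)")
    case False
    then have "int p dvd j" using socle_dvd_exponent[OF C s(1,3), of j] sj by auto
    then have "A r = \<one>" using socle_pow_eq_one[OF s(1,3)] socle_pow_eq_one[OF r(1,2)] j i by simp
    then show False using r(3) by simp
  next
    case True
    then obtain m :: int where m: "s = r [^] m" by blast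
    have "s [^] i = (A r) [^] m" using m i r(1) by (simp add: int_pow_pow mult.commute)
    also have "\<dots> = A s" using m endo_int_pow_hom[OF A r(1)] by simp
    finally have "int p dvd i" using socle_dvd_exponent[OF triv_subgroup s(1,3), of i] s by simp
    then show False using socle_pow_eq_one[OF r(1,2)] i r(3) by simp
  qed
qed

theorem generalized_t_fine_endo: "generalized_t_fine (endo_ring G)"
proof -
  interpret R: ring "endo_ring G" by (rule ring_endo)
  have "\<exists>u\<in>Units (endo_ring G). \<exists>n\<in>nilpotents (endo_ring G). A = u \<oplus>\<^bsub>endo_ring G\<^esub> n"
    if A: "A \<in> carrier (endo_ring G)" "A \<notin> jacobson_radical (endo_ring G)" for A
  proof (cases "\<exists>s\<in>carrier G. s [^] p = \<one> \<and> A s \<notin> range (\<lambda>i::int. s [^] i)")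
    case True
    then show ?thesis using unit_plus_nilpotent_if_moves_socle_line[OF A(1)] by blast
  next
    case False
    then have lines: "A s \<in> range (\<lambda>i::int. s [^] i)" if "s \<in> carrier G" "s [^] p = \<one>" for s
      using that by blast
    have "\<exists>r\<in>carrier G. r [^] p = \<one> \<and> A r \<noteq> \<one>"
    proof (rule ccontr)
      assume kill: "\<not> ?thesis"
      \<comment> \<open>A nontrivial fixed point of \<open>g A\<close> would have a nontrivial power
        in the socle. That power is again fixed, although \<open>A\<close> kills it.\<close>
      have "A \<in> jacobson_radical (endo_ring G)"
      proof (rule endo_in_jacobson_radicalI[OF A(1)], rule ccontr)
        fix g x assume g: "g \<in> carrier (endo_ring G)" and x: "x \<in> carrier G" "g (A x) = x" "x \<noteq> \<one>"
        obtain k :: nat where k: "x [^] k \<noteq> \<one>" "(x [^] k) [^] p = \<one>"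
          using power_in_socle[OF x(1,3)] by blast
        have "x [^] k = g (A (x [^] k))" using g x A(1) by (simp add: endo_nat_pow_hom)
        also have "A (x [^] k) = \<one>" using kill k(2) x(1) by blast
        finally show False using k(1) g by simp
      qed
      then show False using A(2) by blast
    qed
    \<comment> \<open>In this case the nilpotent summand is zero.\<close>
    then have "A \<in> Units (endo_ring G)" using unit_if_fixes_socle_lines[OF A(1) lines] by blast
    moreover have "\<zero>\<^bsub>endo_ring G\<^esub> \<in> nilpotents (endo_ring G)"
      by (rule endo_in_nilpotentsI[of _ 1]) auto
    moreover have "A = A \<oplus>\<^bsub>endo_ring G\<^esub> \<zero>\<^bsub>endo_ring G\<^esub>" using A(1) by simp
    ultimately show ?thesis by blast
  qed
  moreover have "u \<oplus>\<^bsub>endo_ring G\<^esub> n \<in> carrier (endo_ring G)"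
    if "u \<in> Units (endo_ring G)" "n \<in> nilpotents (endo_ring G)" for u n
    using that by (auto simp: nilpotents_def)
  ultimately show ?thesis
    unfolding generalized_t_fine_endo_iff
    using unit_plus_nilpotent_notin_jacobson_radical[OF nontrivial] by blast
qed

end

section \<open>Finite abelian groups with generalized t-fine endomorphism ring\<close>

theorem theorem2p22:
  fixes G :: "('a, 'b) monoid_scheme"
  assumes "comm_group G" and "finite (carrier G)"
  shows "generalized_t_fine (endo_ring G) \<longleftrightarrow>
    (\<exists>(p::nat) (k::nat) (n::nat). Factorial_Ring.prime p \<and> k \<ge> 1 \<and> n \<ge> 1 \<and>
       G \<cong> product_group {..<n} (\<lambda>_. integer_mod_group (p ^ k)))"
proof -
  interpret finite_comm_group G
    using assms by (simp add: finite_comm_group_def finite_comm_group_axioms_def)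
  show ?thesis
  proof
    assume "generalized_t_fine (endo_ring G)"
    then obtain p l where "homocyclic_group G p l" using t_fine_imp_homocyclic by blast
    then interpret homocyclic_group G p l .
    obtain n :: nat where "n \<ge> 1" "G \<cong> product_group {..<n} (\<lambda>_. integer_mod_group (p ^ Suc l))"
      using iso_product by blast
    moreover have "Suc l \<ge> 1" by simp
    ultimately show "\<exists>(p::nat) (k::nat) (n::nat). Factorial_Ring.prime p \<and> k \<ge> 1 \<and> n \<ge> 1 \<and>
       G \<cong> product_group {..<n} (\<lambda>_. integer_mod_group (p ^ k))"
      using prime by blast
  next
    assume "\<exists>(p::nat) (k::nat) (n::nat). Factorial_Ring.prime p \<and> k \<ge> 1 \<and> n \<ge> 1 \<and>
       G \<cong> product_group {..<n} (\<lambda>_. integer_mod_group (p ^ k))"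
    then obtain p k n :: nat where pkn: "Factorial_Ring.prime p" "k \<ge> 1" "n \<ge> 1"
      "G \<cong> product_group {..<n} (\<lambda>_. integer_mod_group (p ^ k))"
      by blast
    obtain l where "k = Suc l" using pkn(2) by (cases k) auto
    then have "homocyclic_group G p l" using iso_product_imp_homocyclic[OF pkn(1,3)] pkn(4) by simp
    then show "generalized_t_fine (endo_ring G)"
      by (rule homocyclic_group.generalized_t_fine_endo)
  qed
qed

end
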